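(* Let $G$ be a nontrivial finite cyclic group, and let $H_1,\ldots,H_k$ be all of its (pairwise distinct) subgroups. Then there do not exist $(m_1,\ldots,m_k)\in\mathbb{Z}^k$ with $(m_1,\ldots,m_k)\neq\mathbf{0}$ and $q\in\mathbb{Q}$ satisfying the following condition: for any Galois cover $Y/X$ of finite connected graphs with $\operatorname{Gal}(Y/X)=G$, $$q\cdot\prod_{i=1}^{k}\kappa(X_i)^{m_i}=1,$$ where $X_i$ is the intermediate graph of $Y/X$ corresponding to $H_i$.
   Context: Graphs (in the sense of Serre): a graph $X=(V_X,E_X,o,t,\iota)$ consists of sets $V_X$ (vertices), $E_X$ (oriented edges) and maps $o,t\colon E_X\to V_X$, $\iota\colon E_X\to E_X$ with $\iota(\iota(e))=e$, $\iota(e)\neq e$, $o(\iota(e))=t(e)$, $t(\iota(e))=o(e)$ for all $e\in E_X$. Write $\bar e=\iota(e)$. Loops and multiple edges are allowed; each pair $\{e,\bar e\}$ is one undirected edge. The complexity $\kappa(X)$ of a finite connected graph $X$ is its number of spanning trees. A morphism $f\colon Y\to X$ is a pair of maps $V_Y\to V_X$, $E_Y\to E_X$ (both written $f$) commuting with $o$, $t$, $\iota$; it is an isomorphism if both maps are bijective. A covering map (cover) $\pi\colon Y\to X$ is a morphism that is surjective on vertices and such that for each $w\in V_Y$ it restricts to a bijection $\{e\in E_Y\mid o(e)=w\}\to\{e\in E_X\mid o(e)=\pi(w)\}$. $\operatorname{Aut}(Y/X)$ is the group of isomorphisms $\sigma\colon Y\to Y$ with $\pi\circ\sigma=\pi$.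 A cover $\pi\colon Y\to X$ is a Galois cover if $Y$ is connected and $\operatorname{Aut}(Y/X)$ acts transitively on each fiber $\pi^{-1}(v)$, $v\in V_X$; then one writes $\operatorname{Gal}(Y/X)=\operatorname{Aut}(Y/X)$. For a subgroup $H\le\operatorname{Gal}(Y/X)$, the intermediate graph $X_H$ corresponding to $H$ (under the Galois correspondence between subgroups and equivalence classes of intermediate covers $Y\to X_H\to X$) is the quotient graph of $Y$ by $H$; so $X_{\{1\}}=Y$ and $X_G=X$. *)

theory Defs
  imports "HOL-Algebra.Elementary_Groups" "HOL-Algebra.Group_Action"
    "Graph_Theory.Graph_Theory"
begin

text \<open>
  A graph in the sense of Serre is a pair of a digraph \<open>G\<close> and an edge reversal \<open>\<iota>\<close> with
  \<^locale>\<open>bidirected_digraph\<close> \<open>G \<iota>\<close>; the origin and terminus maps are \<^const>\<open>tail\<close> and \<^const>\<open>head\<close>.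
  That locale also makes \<open>\<iota>\<close> the identity off the edge set, which is only a normalisation.
  A morphism is a pair consisting of its vertex map and its edge map.
\<close>

definition graph_morphism ::
  "('v, 'e) pre_digraph \<Rightarrow> ('e \<Rightarrow> 'e) \<Rightarrow> ('w, 'f) pre_digraph \<Rightarrow> ('f \<Rightarrow> 'f) \<Rightarrow>
   ('v \<Rightarrow> 'w) \<times> ('e \<Rightarrow> 'f) \<Rightarrow> bool"
  where "graph_morphism Y \<iota>Y B \<iota>B f \<longleftrightarrow>
    fst f ` verts Y \<subseteq> verts B \<and> snd f ` arcs Y \<subseteq> arcs B \<and>
    (\<forall>e \<in> arcs Y. tail B (snd f e) = fst f (tail Y e) \<and>
                  head B (snd f e) = fst f (head Y e) \<and>
                  \<iota>B (snd f e) = snd f (\<iota>Y e))"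

definition graph_cover ::
  "('v, 'e) pre_digraph \<Rightarrow> ('e \<Rightarrow> 'e) \<Rightarrow> ('w, 'f) pre_digraph \<Rightarrow> ('f \<Rightarrow> 'f) \<Rightarrow>
   ('v \<Rightarrow> 'w) \<times> ('e \<Rightarrow> 'f) \<Rightarrow> bool"
  where "graph_cover Y \<iota>Y B \<iota>B \<pi> \<longleftrightarrow>
    bidirected_digraph Y \<iota>Y \<and> bidirected_digraph B \<iota>B \<and>
    graph_morphism Y \<iota>Y B \<iota>B \<pi> \<and>
    fst \<pi> ` verts Y = verts B \<and>
    (\<forall>w \<in> verts Y. bij_betw (snd \<pi>) (out_arcs Y w) (out_arcs B (fst \<pi> w)))"

text \<open>
  The group \<open>Aut(Y/B)\<close>. As in \<^const>\<open>AutoGroup\<close>, automorphisms are represented by extensional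
  maps, so that each one has a unique representative.
\<close>

definition deck_group ::
  "('v, 'e) pre_digraph \<Rightarrow> ('e \<Rightarrow> 'e) \<Rightarrow> ('v \<Rightarrow> 'w) \<times> ('e \<Rightarrow> 'f) \<Rightarrow>
   (('v \<Rightarrow> 'v) \<times> ('e \<Rightarrow> 'e)) monoid"
  where "deck_group Y \<iota>Y \<pi> = (BijGroup (verts Y) \<times>\<times> BijGroup (arcs Y))
    \<lparr>carrier := {\<sigma> \<in> Bij (verts Y) \<times> Bij (arcs Y).
       graph_morphism Y \<iota>Y Y \<iota>Y \<sigma> \<and>
       (\<forall>v \<in> verts Y. fst \<pi> (fst \<sigma> v) = fst \<pi> v) \<and>
       (\<forall>e \<in> arcs Y. snd \<pi> (snd \<sigma> e) = snd \<pi> e)}\<rparr>"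

definition galois_cover ::
  "('v, 'e) pre_digraph \<Rightarrow> ('e \<Rightarrow> 'e) \<Rightarrow> ('w, 'f) pre_digraph \<Rightarrow> ('f \<Rightarrow> 'f) \<Rightarrow>
   ('v \<Rightarrow> 'w) \<times> ('e \<Rightarrow> 'f) \<Rightarrow> bool"
  where "galois_cover Y \<iota>Y B \<iota>B \<pi> \<longleftrightarrow>
    graph_cover Y \<iota>Y B \<iota>B \<pi> \<and> Digraph_Component.connected Y \<and>
    (\<forall>v \<in> verts B. \<forall>w \<in> verts Y. \<forall>w' \<in> verts Y.
       fst \<pi> w = v \<and> fst \<pi> w' = v \<longrightarrow>
       (\<exists>\<sigma> \<in> carrier (deck_group Y \<iota>Y \<pi>). fst \<sigma> w = w'))"

text \<open>
  The quotient of \<open>Y\<close> by a group \<open>K\<close> of automorphisms. The endpoints and the reversal of an edge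
  orbit are computed by taking images: since \<open>K\<close> commutes with \<^const>\<open>tail\<close>, \<^const>\<open>head\<close> and
  \<open>\<iota>Y\<close>, the image of the orbit of an edge is the orbit of its image.
\<close>

definition quotient_graph ::
  "(('v \<Rightarrow> 'v) \<times> ('e \<Rightarrow> 'e), 'x) monoid_scheme \<Rightarrow> ('v, 'e) pre_digraph \<Rightarrow>
   ('v set, 'e set) pre_digraph"
  where "quotient_graph K Y =
    \<lparr>verts = Group_Action.orbits K (verts Y) fst, arcs = Group_Action.orbits K (arcs Y) snd,
     tail = (\<lambda>A. tail Y ` A), head = (\<lambda>A. head Y ` A)\<rparr>"

definition quotient_rev ::
  "(('v \<Rightarrow> 'v) \<times> ('e \<Rightarrow> 'e), 'x) monoid_scheme \<Rightarrow> ('v, 'e) pre_digraph \<Rightarrow> ('e \<Rightarrow> 'e) \<Rightarrow>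
   'e set \<Rightarrow> 'e set"
  where "quotient_rev K Y \<iota>Y A = (if A \<in> Group_Action.orbits K (arcs Y) snd then \<iota>Y ` A else A)"

text \<open>
  \<^const>\<open>forest\<close> and \<^const>\<open>spanning_tree\<close> are notions for directed graphs, for which the closed walk
  \<open>[e, \<iota> e]\<close> is a cycle. Here it must not count: a circuit is a \<^const>\<open>pre_digraph.cycle\<close> (a closed
  walk of positive length without repeated vertices, a loop being allowed) that does not traverse
  an edge in both directions.
\<close>

definition circuit :: "('v, 'e) pre_digraph \<Rightarrow> ('e \<Rightarrow> 'e) \<Rightarrow> 'e list \<Rightarrow> bool"
  where "circuit G \<iota> p \<longleftrightarrow> pre_digraph.cycle G p \<and> (\<forall>e \<in> set p. \<iota> e \<notin> set p)"

definition spanning_trees :: "('v, 'e) pre_digraph \<Rightarrow> ('e \<Rightarrow> 'e) \<Rightarrow> ('v, 'e) pre_digraph set"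
  where "spanning_trees G \<iota> =
    {T. spanning T G \<and> \<iota> ` arcs T \<subseteq> arcs T \<and>
        Digraph_Component.connected T \<and> \<not> (\<exists>p. circuit T \<iota> p)}"

definition complexity :: "('v, 'e) pre_digraph \<Rightarrow> ('e \<Rightarrow> 'e) \<Rightarrow> nat"
  where "complexity G \<iota> = card (spanning_trees G \<iota>)"

text \<open>The complexity of the intermediate graph of \<open>Y/B\<close> corresponding to the subgroup \<open>H\<close> of
  \<open>Gal(Y/B)\<close>.\<close>

definition intermediate_complexity ::
  "('v, 'e) pre_digraph \<Rightarrow> ('e \<Rightarrow> 'e) \<Rightarrow> ('v \<Rightarrow> 'w) \<times> ('e \<Rightarrow> 'f) \<Rightarrow>
   (('v \<Rightarrow> 'v) \<times> ('e \<Rightarrow> 'e)) set \<Rightarrow> nat"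
  where "intermediate_complexity Y \<iota>Y \<pi> H =
    (let K = (deck_group Y \<iota>Y \<pi>)\<lparr>carrier := H\<rparr>
     in complexity (quotient_graph K Y) (quotient_rev K Y \<iota>Y))"

end

theory Submission
  imports Defs "HOL-Algebra.Multiplicative_Group" "HOL-Number_Theory.Totient"
begin

text \<open>
  Let \<open>n\<close> be the order of the group, and for a divisor \<open>c\<close> of \<open>n\<close> and \<open>a \<ge> 1\<close> take as base the dipole
  with two vertices \<open>u\<close>, \<open>v\<close> and \<open>2a + 1\<close> edges from \<open>u\<close> to \<open>v\<close>: one of voltage 1, \<open>a\<close> of voltage 0
  and \<open>a\<close> of voltage \<open>c\<close>, all in \<open>\<int>/n\<close>. The intermediate graph of the derived cover for the subgroup
  of index \<open>e\<close> is the derived graph over \<open>\<int>/e\<close>. It has \<open>2e\<close> vertices, and its edges of voltage 0 and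
  \<open>c\<close> form a subgraph with \<open>gcd e c\<close> components, hence of rank \<open>2e - gcd e c\<close>. Since these edges come
  in \<open>a\<close> parallel copies, the complexity is of order \<open>a\<close> to the power \<open>2e - gcd e c\<close> as \<open>a\<close> grows. A
  multiplicative relation with exponents \<open>m\<^sub>e\<close> therefore forces \<open>\<Sum> m\<^sub>e (2e - gcd e c) = 0\<close> for all
  \<open>c\<close>; taking \<open>c = n\<close> gives \<open>\<Sum> m\<^sub>e e = 0\<close>, so \<open>\<Sum> m\<^sub>e gcd e c = 0\<close> for all \<open>c\<close>, and the matrix of
  greatest common divisors is nonsingular.
\<close>

section \<open>Saturated sets and spanning trees\<close>

text \<open>
  The number of saturated sets is 2 to the number of connected components. Adding an edge halves it
  or leaves it unchanged, which yields the rank theory of the graphic matroid without paths.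
\<close>

definition saturated :: "'v set \<Rightarrow> ('e \<Rightarrow> 'v) \<Rightarrow> ('e \<Rightarrow> 'v) \<Rightarrow> 'e set \<Rightarrow> 'v set set"
  where "saturated V s t S = {U. U \<subseteq> V \<and> (\<forall>e \<in> S. s e \<in> U \<longleftrightarrow> t e \<in> U)}"

text \<open>The edge sets of the spanning trees of a multigraph whose undirected edges are listed
  once each: having only trivial saturated sets means connectedness, and the edge count then
  excludes cycles.\<close>

definition tree_sets :: "'v set \<Rightarrow> ('e \<Rightarrow> 'v) \<Rightarrow> ('e \<Rightarrow> 'v) \<Rightarrow> 'e set \<Rightarrow> 'e set set"
  where "tree_sets V s t E = {S. S \<subseteq> E \<and> saturated V s t S = {{}, V} \<and> card S + 1 = card V}"

text \<open>Forests, for edges with ends in \<open>V\<close>: the number of components is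
  \<open>card V - card S\<close>. The multiplicative form avoids logarithms and truncated
  subtraction.\<close>

definition acyclic_set :: "'v set \<Rightarrow> ('e \<Rightarrow> 'v) \<Rightarrow> ('e \<Rightarrow> 'v) \<Rightarrow> 'e set \<Rightarrow> bool"
  where "acyclic_set V s t S \<longleftrightarrow> finite S \<and> card (saturated V s t S) * 2 ^ card S = 2 ^ card V"

lemma saturated_Un: "saturated V s t (A \<union> B) = saturated V s t A \<inter> saturated V s t B"
  by (auto simp: saturated_def)

lemma saturated_antimono: "A \<subseteq> B \<Longrightarrow> saturated V s t B \<subseteq> saturated V s t A"
  by (auto simp: saturated_def)

lemma saturated_subset_Pow: "saturated V s t A \<subseteq> Pow V"
  by (auto simp: saturated_def)

lemma finite_saturated: "finite V \<Longrightarrow> finite (saturated V s t A)"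
  by (rule finite_subset[OF saturated_subset_Pow]) simp

lemma trivial_in_saturated:
  assumes "\<And>e. e \<in> S \<Longrightarrow> s e \<in> V \<and> t e \<in> V"
  shows "{{}, V} \<subseteq> saturated V s t S"
  using assms by (auto simp: saturated_def)

lemma saturated_empty: "saturated V s t {} = Pow V"
  by (auto simp: saturated_def)

lemma saturated_reindex:
  assumes "\<And>e. e \<in> S \<Longrightarrow> s (\<rho> e) = s e \<and> t (\<rho> e) = t e"
  shows "saturated V s t (\<rho> ` S) = saturated V s t S"
  using assms by (auto simp: saturated_def)

lemma saturated_insert_linked:
  assumes "\<And>U. U \<in> saturated V s t S \<Longrightarrow> s e \<in> U \<longleftrightarrow> t e \<in> U"
  shows "saturated V s t (insert e S) = saturated V s t S"
  using assms by (auto simp: saturated_def)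

text \<open>Symmetric difference with \<open>U0\<close> is an involution that flips whether a set
  separates the ends of \<open>e\<close>. So exactly half of the saturated sets survive the
  insertion of \<open>e\<close>, which merges two components.\<close>

lemma card_saturated_insert_separated:
  assumes "finite V" and U0: "U0 \<in> saturated V s t S" "(s e \<in> U0) \<noteq> (t e \<in> U0)"
    and V: "s e \<in> V" "t e \<in> V" "\<And>f. f \<in> S \<Longrightarrow> s f \<in> V \<and> t f \<in> V"
  shows "card (saturated V s t S) = 2 * card (saturated V s t (insert e S))"
proof -
  let ?Z = "saturated V s t"
  let ?f = "\<lambda>U. (U - U0) \<union> (U0 - U)"
  have ff: "?f (?f U) = U" for U by auto
  have "bij_betw ?f (?Z (insert e S)) (?Z S - ?Z (insert e S))"
  proof (rule bij_betw_byWitness[where f' = ?f])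
    show "?f ` ?Z (insert e S) \<subseteq> ?Z S - ?Z (insert e S)"
      "?f ` (?Z S - ?Z (insert e S)) \<subseteq> ?Z (insert e S)"
      using U0 V unfolding saturated_def by (auto 4 4)
  qed (auto simp: ff)
  then have "card (?Z (insert e S)) = card (?Z S - ?Z (insert e S))"
    by (rule bij_betw_same_card)
  also have "\<dots> = card (?Z S) - card (?Z (insert e S))"
    by (intro card_Diff_subset finite_saturated saturated_antimono) (use assms in auto)
  moreover have "card (?Z (insert e S)) \<le> card (?Z S)"
    by (intro card_mono finite_saturated saturated_antimono) (use assms in auto)
  ultimately show ?thesis by linarith
qed

text \<open>The edges of \<open>B\<close> are added one at a time; each leaves the count unchanged
  or halves it.\<close>

lemma card_saturated_Un_ge:
  assumes "finite V" "finite B" "\<And>f. f \<in> A \<union> B \<Longrightarrow> s f \<in> V \<and> t f \<in> V"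
  shows "card (saturated V s t A) \<le> card (saturated V s t (A \<union> B)) * 2 ^ card B"
  using assms(2,3)
proof (induction B rule: finite_induct)
  case (insert e B)
  let ?Z = "saturated V s t"
  have "card (?Z (A \<union> B)) \<le> 2 * card (?Z (insert e (A \<union> B)))"
  proof (cases "\<forall>U \<in> ?Z (A \<union> B). s e \<in> U \<longleftrightarrow> t e \<in> U")
    case True
    then have "?Z (insert e (A \<union> B)) = ?Z (A \<union> B)"
      by (intro saturated_insert_linked) auto
    then show ?thesis by simp
  next
    case False
    then obtain U0 where U0: "U0 \<in> ?Z (A \<union> B)" "(s e \<in> U0) \<noteq> (t e \<in> U0)" by blast
    have "card (?Z (A \<union> B)) = 2 * card (?Z (insert e (A \<union> B)))"
      by (rule card_saturated_insert_separated[OF \<open>finite V\<close> U0]) (use insert.prems in auto)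
    then show ?thesis by simp
  qed
  then have "card (?Z (A \<union> B)) * 2 ^ card B \<le> card (?Z (insert e (A \<union> B))) * 2 ^ card (insert e B)"
    using insert.hyps by simp
  moreover have "card (?Z A) \<le> card (?Z (A \<union> B)) * 2 ^ card B"
    using insert by auto
  ultimately show ?case by simp
qed simp

section \<open>Forests and their extension\<close>

lemma card_saturated_ge:
  assumes "finite V" "finite S" "\<And>f. f \<in> S \<Longrightarrow> s f \<in> V \<and> t f \<in> V"
  shows "2 ^ card V \<le> card (saturated V s t S) * 2 ^ card S"
  using card_saturated_Un_ge[of V S "{}" s t] assms by (simp add: saturated_empty card_Pow)

text \<open>Restoring the edges of \<open>B - A\<close> costs at most a factor
  \<open>2 ^ card (B - A)\<close>, so the equality for \<open>B\<close> bounds the count for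
  \<open>A\<close> from above; \<open>card_saturated_ge\<close> is the matching lower bound.\<close>

lemma acyclic_set_subset:
  assumes "finite V" "acyclic_set V s t B" "A \<subseteq> B" "\<And>f. f \<in> B \<Longrightarrow> s f \<in> V \<and> t f \<in> V"
  shows "acyclic_set V s t A"
proof -
  let ?Z = "saturated V s t"
  have fin: "finite B" "finite A"
    using assms finite_subset by (auto simp: acyclic_set_def)
  have "card (?Z A) \<le> card (?Z (A \<union> (B - A))) * 2 ^ card (B - A)"
    by (rule card_saturated_Un_ge) (use assms fin in auto)
  moreover have "A \<union> (B - A) = B" "card B = card (B - A) + card A"
    using assms(3) fin by (auto simp: card_Diff_subset card_mono)
  ultimately have "card (?Z A) * 2 ^ card A \<le> card (?Z B) * 2 ^ card B"
    by (simp add: power_add)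
  moreover have "2 ^ card V \<le> card (?Z A) * 2 ^ card A"
    by (rule card_saturated_ge) (use assms fin in auto)
  ultimately show ?thesis
    using assms(2) fin by (simp add: acyclic_set_def)
qed

lemma acyclic_set_insert:
  assumes "finite V" "acyclic_set V s t S" "e \<notin> S"
    and "U \<in> saturated V s t S" "(s e \<in> U) \<noteq> (t e \<in> U)"
    and "\<And>f. f \<in> insert e S \<Longrightarrow> s f \<in> V \<and> t f \<in> V"
  shows "acyclic_set V s t (insert e S)"
  using card_saturated_insert_separated[OF assms(1,4,5)] assms(2,3,6)
  by (auto simp: acyclic_set_def)

text \<open>Basis extension in the graphic matroid, done greedily: an edge of \<open>E\<close> is
  taken only when some current saturated set separates its ends; a skipped edge does not change the
  saturated sets.\<close>

lemma acyclic_set_extend: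
  assumes "finite V" "finite E" "acyclic_set V s t A" "\<And>f. f \<in> A \<union> E \<Longrightarrow> s f \<in> V \<and> t f \<in> V"
  shows "\<exists>B \<subseteq> E. A \<inter> B = {} \<and> acyclic_set V s t (A \<union> B) \<and>
    saturated V s t (A \<union> B) = saturated V s t (A \<union> E)"
  using assms(2,4)
proof (induction E rule: finite_induct)
  case empty
  then show ?case using assms(3) by auto
next
  case (insert e E)
  let ?Z = "saturated V s t"
  from insert obtain B where B: "B \<subseteq> E" "A \<inter> B = {}" "acyclic_set V s t (A \<union> B)"
    "?Z (A \<union> B) = ?Z (A \<union> E)" by auto
  have eq: "?Z (insert e (A \<union> B)) = ?Z (A \<union> insert e E)"
    using B(4) saturated_Un[of V s t "{e}"] by (metis Un_insert_right insert_is_Un)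
  show ?case
  proof (cases "\<forall>U \<in> ?Z (A \<union> B). s e \<in> U \<longleftrightarrow> t e \<in> U")
    case True
    then have "?Z (insert e (A \<union> B)) = ?Z (A \<union> B)"
      by (intro saturated_insert_linked) auto
    then show ?thesis using B eq by (intro exI[of _ B]) auto
  next
    case False
    then obtain U where U: "U \<in> ?Z (A \<union> B)" "(s e \<in> U) \<noteq> (t e \<in> U)" by blast
    then have "e \<notin> A \<union> B" by (auto simp: saturated_def)
    moreover from this have "acyclic_set V s t (insert e (A \<union> B))"
      using acyclic_set_insert[OF assms(1) B(3) _ U] insert.prems B(1) by auto
    ultimately show ?thesis using B eq by (intro exI[of _ "insert e B"]) auto
  qed
qed

text \<open>A connected graph has exactly two saturated sets, so the defining equality becomes
  \<open>2 * 2 ^ card S = 2 ^ card V\<close>.\<close>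

lemma acyclic_set_if_spanning:
  assumes "finite V" "V \<noteq> {}" "finite S" "saturated V s t S = {{}, V}"
  shows "acyclic_set V s t S \<longleftrightarrow> card S + 1 = card V"
proof -
  have "card (saturated V s t S) = 2" using assms(2,4) by simp
  then have "acyclic_set V s t S \<longleftrightarrow> (2::nat) ^ (card S + 1) = 2 ^ card V"
    using assms(3) by (simp add: acyclic_set_def)
  then show ?thesis by (simp only: power_inject_exp)
qed

text \<open>The right-hand side says that every edge is a bridge. If \<open>e\<close> is not one,
  then \<open>S\<close> and the forest \<open>S - {e}\<close> have equally many saturated sets,
  contradicting the count. Conversely the edges can be inserted one by one, since a set saturated
  for \<open>S - {e}\<close> is saturated for every smaller edge set.\<close>

lemma acyclic_set_iff_separated:
  assumes "finite V" "finite S" "\<And>f. f \<in> S \<Longrightarrow> s f \<in> V \<and> t f \<in> V"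
  shows "acyclic_set V s t S \<longleftrightarrow>
    (\<forall>e \<in> S. \<exists>U \<in> saturated V s t (S - {e}). (s e \<in> U) \<noteq> (t e \<in> U))"
proof
  assume acyc: "acyclic_set V s t S"
  show "\<forall>e \<in> S. \<exists>U \<in> saturated V s t (S - {e}). (s e \<in> U) \<noteq> (t e \<in> U)"
  proof (rule ccontr)
    assume "\<not> ?thesis"
    then obtain e where e: "e \<in> S"
      "\<And>U. U \<in> saturated V s t (S - {e}) \<Longrightarrow> s e \<in> U \<longleftrightarrow> t e \<in> U" by blast
    then have "saturated V s t S = saturated V s t (S - {e})"
      using saturated_insert_linked[of V s t "S - {e}" e] by (simp add: insert_absorb)
    moreover have "acyclic_set V s t (S - {e})"
      by (rule acyclic_set_subset[OF assms(1) acyc]) (use assms in auto)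
    ultimately have "card (saturated V s t S) * 2 ^ card (S - {e}) = 2 ^ card V"
      by (simp add: acyclic_set_def)
    moreover have "card (saturated V s t S) * (2 * 2 ^ card (S - {e})) = 2 ^ card V"
      using acyc card.remove[OF assms(2) e(1)] by (simp add: acyclic_set_def)
    ultimately have "(2::nat) * 2 ^ card V = 2 ^ card V" by (simp add: mult.left_commute)
    then show False by simp
  qed
next
  assume sep: "\<forall>e \<in> S. \<exists>U \<in> saturated V s t (S - {e}). (s e \<in> U) \<noteq> (t e \<in> U)"
  have "T \<subseteq> S \<Longrightarrow> acyclic_set V s t T" if "finite T" for T
    using that
  proof (induction T rule: finite_induct)
    case empty
    then show ?case using assms(1) by (simp add: acyclic_set_def saturated_empty card_Pow)
  next
    case (insert e T)
    then obtain U where U: "U \<in> saturated V s t (S - {e})" "(s e \<in> U) \<noteq> (t e \<in> U)"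
      using sep by auto
    moreover have "saturated V s t (S - {e}) \<subseteq> saturated V s t T"
      using insert by (intro saturated_antimono) auto
    ultimately show ?case
      using insert assms by (intro acyclic_set_insert[where U = U]) auto
  qed
  then show "acyclic_set V s t S" using assms(2) by simp
qed

section \<open>Bounds for the number of spanning trees\<close>

lemma card_subsets_bounded_le:
  assumes "finite F"
  shows "card {A. A \<subseteq> F \<and> card A \<le> r} \<le> (card F + 1) ^ r"
proof -
  \<comment> \<open>Subsets of size at most \<open>r\<close> are encoded as lists of length exactly
    \<open>r\<close>, with \<open>None\<close> as padding; hence the base
    \<open>card F + 1\<close>.\<close>
  let ?X = "insert None (Some ` F)"
  let ?L = "{xs. set xs \<subseteq> ?X \<and> length xs = r}"
  have "{A. A \<subseteq> F \<and> card A \<le> r} \<subseteq> (\<lambda>xs. {x. Some x \<in> set xs}) ` ?L"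
  proof
    fix A assume "A \<in> {A. A \<subseteq> F \<and> card A \<le> r}"
    then have A: "A \<subseteq> F" "card A \<le> r" by auto
    then obtain ys where ys: "set ys = A" "length ys = card A"
      using assms by (metis distinct_card finite_distinct_list finite_subset)
    let ?xs = "map Some ys @ replicate (r - card A) None"
    have "?xs \<in> ?L" using ys A by (auto simp: set_replicate_conv_if)
    moreover have "{x. Some x \<in> set ?xs} = A" using ys by auto
    ultimately show "A \<in> (\<lambda>xs. {x. Some x \<in> set xs}) ` ?L" by blast
  qed
  moreover have "finite ?L" by (rule finite_lists_length_eq) (use assms in simp)
  ultimately have "card {A. A \<subseteq> F \<and> card A \<le> r} \<le> card ?L"
    by (rule surj_card_le[rotated])
  also have "\<dots> = card ?X ^ r" by (rule card_lists_length_eq) (use assms in simp)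
  also have "card ?X = card F + 1" using assms by (simp add: card_image)
  finally show ?thesis .
qed

text \<open>A tree is determined by its traces on \<open>P\<close> and \<open>F\<close>. The trace
  on \<open>F\<close> is a forest, so its size is at most the rank \<open>r\<close> of
  \<open>F\<close>; the trace on \<open>P\<close> is arbitrary.\<close>

lemma card_tree_sets_le:
  assumes "finite V" "V \<noteq> {}" "finite P" "finite F"
    and ends: "\<And>f. f \<in> P \<union> F \<Longrightarrow> s f \<in> V \<and> t f \<in> V"
    and rank: "card (saturated V s t F) * 2 ^ r = 2 ^ card V"
  shows "card (tree_sets V s t (P \<union> F)) \<le> 2 ^ card P * (card F + 1) ^ r"
proof -
  let ?\<F> = "{A. A \<subseteq> F \<and> card A \<le> r}"
  have sub: "(\<lambda>S. (S \<inter> P, S \<inter> F)) ` tree_sets V s t (P \<union> F) \<subseteq> Pow P \<times> ?\<F>"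
  proof (rule image_subsetI)
    fix S assume "S \<in> tree_sets V s t (P \<union> F)"
    then have S: "S \<subseteq> P \<union> F" "saturated V s t S = {{}, V}" "card S + 1 = card V"
      by (simp_all add: tree_sets_def)
    then have "finite S" using assms(3,4) finite_subset by blast
    then have "acyclic_set V s t S"
      using acyclic_set_if_spanning[OF assms(1,2) _ S(2)] S(3) by simp
    then have "acyclic_set V s t (S \<inter> F)"
      by (rule acyclic_set_subset[OF assms(1)]) (use ends S(1) in auto)
    then have "card (saturated V s t (S \<inter> F)) * 2 ^ card (S \<inter> F)
      = card (saturated V s t F) * 2 ^ r"
      using rank by (simp add: acyclic_set_def)
    also have "\<dots> \<le> card (saturated V s t (S \<inter> F)) * 2 ^ r"
      by (intro mult_right_mono card_mono finite_saturated saturated_antimono) (use assms in auto)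
    finally have "card (saturated V s t (S \<inter> F)) = 0 \<or> (2::nat) ^ card (S \<inter> F) \<le> 2 ^ r"
      by auto
    moreover have "card (saturated V s t (S \<inter> F)) \<noteq> 0"
      using \<open>acyclic_set V s t (S \<inter> F)\<close>
      by (metis acyclic_set_def mult_0 power_not_zero zero_neq_numeral)
    ultimately have "card (S \<inter> F) \<le> r" by simp
    then show "(S \<inter> P, S \<inter> F) \<in> Pow P \<times> ?\<F>" by simp
  qed
  have inj: "inj_on (\<lambda>S. (S \<inter> P, S \<inter> F)) (tree_sets V s t (P \<union> F))"
    by (rule inj_onI) (auto simp: tree_sets_def)
  have "card (tree_sets V s t (P \<union> F)) \<le> card (Pow P \<times> ?\<F>)"
    by (rule card_inj_on_le[OF inj sub]) (use assms in auto)
  also have "\<dots> \<le> 2 ^ card P * (card F + 1) ^ r"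
    using card_subsets_bounded_le[OF \<open>finite F\<close>] \<open>finite P\<close>
    by (simp add: card_cartesian_product card_Pow)
  finally show ?thesis .
qed

text \<open>Any tree with \<open>r\<close> edges in \<open>R\<close> yields \<open>a ^ r\<close> trees, by replacing each of these edges by
  any of its \<open>a\<close> parallel copies \<open>\<rho> e i\<close>.\<close>

lemma card_tree_sets_ge:
  fixes \<rho> :: "'e \<Rightarrow> nat \<Rightarrow> 'e"
  assumes "finite V" "V \<noteq> {}" "finite P" "finite R" "finite E" "P \<inter> R = {}"
    and ends: "\<And>f. f \<in> P \<union> R \<Longrightarrow> s f \<in> V \<and> t f \<in> V"
    and rank: "card (saturated V s t R) * 2 ^ r = 2 ^ card V"
    and span: "saturated V s t (P \<union> R) = {{}, V}"
    and \<rho>_ends: "\<And>e i. e \<in> R \<Longrightarrow> i < a \<Longrightarrow> s (\<rho> e i) = s e \<and> t (\<rho> e i) = t e"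
    and \<rho>_inj: "\<And>e i e' i'. \<lbrakk>e \<in> R; i < a; e' \<in> R; i' < a; \<rho> e i = \<rho> e' i'\<rbrakk> \<Longrightarrow> e = e' \<and> i = i'"
    and \<rho>_in: "\<And>e i. e \<in> R \<Longrightarrow> i < a \<Longrightarrow> \<rho> e i \<in> E - P"
    and "P \<subseteq> E"
  shows "a ^ r \<le> card (tree_sets V s t E)"
proof -
  let ?Z = "saturated V s t"
  have empty: "acyclic_set V s t {}"
    using assms(1) by (simp add: acyclic_set_def saturated_empty card_Pow)
  \<comment> \<open>\<open>B\<close> is a spanning forest of \<open>R\<close>; below,
    \<open>C\<close> completes it to a spanning tree by edges of \<open>P\<close> only, so the edges
    of \<open>B\<close> are the ones to be varied.\<close>
  then obtain B where B: "B \<subseteq> R" "acyclic_set V s t B" "?Z B = ?Z R"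
    using acyclic_set_extend[OF assms(1,4) empty] ends by auto
  have "s f \<in> V \<and> t f \<in> V" if "f \<in> B \<union> P" for f
    using ends[of f] B(1) that by auto
  from acyclic_set_extend[OF assms(1,3) B(2) this]
  obtain C where C: "C \<subseteq> P" "B \<inter> C = {}" "acyclic_set V s t (B \<union> C)" "?Z (B \<union> C) = ?Z (B \<union> P)"
    by auto
  have fin: "finite B" "finite C"
    using B(1) C(1) assms(3,4) by (simp_all add: finite_subset)
  have spanBC: "?Z (B \<union> C) = {{}, V}"
    using C(4) B(3) span by (metis saturated_Un Un_commute)
  have "card (?Z R) \<noteq> 0" using rank by (metis mult_0 power_not_zero zero_neq_numeral)
  moreover have "card (?Z R) * 2 ^ card B = card (?Z R) * 2 ^ r"
    using B rank by (simp add: acyclic_set_def)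
  ultimately have "(2::nat) ^ card B = 2 ^ r" by simp
  then have cardB: "card B = r" by (simp only: power_inject_exp)
  let ?S = "\<lambda>f. (\<lambda>e. \<rho> e (f e)) ` B \<union> C"
  let ?\<Phi> = "B \<rightarrow>\<^sub>E {..<a}"
  have "?S f \<in> tree_sets V s t E" if f: "f \<in> ?\<Phi>" for f
  proof -
    have fa: "f e < a" if "e \<in> B" for e using f that by auto
    have inE: "\<rho> e (f e) \<in> E - P" if "e \<in> B" for e using \<rho>_in fa B(1) that by blast
    have "?Z (?S f) = ?Z (B \<union> C)"
      using saturated_reindex[of B s "\<lambda>e. \<rho> e (f e)" t V] \<rho>_ends fa B(1)
      by (auto simp: saturated_Un)
    moreover have "inj_on (\<lambda>e. \<rho> e (f e)) B"
      using \<rho>_inj fa B(1) by (intro inj_onI) blast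
    then have "card (?S f) = card (B \<union> C)"
      using inE C(1,2) fin by (subst (1 2) card_Un_disjoint) (auto simp: card_image)
    moreover have "card (B \<union> C) + 1 = card V"
      using acyclic_set_if_spanning[of V "B \<union> C" s t] spanBC C(3) assms fin by auto
    ultimately show ?thesis
      using spanBC inE C(1) \<open>P \<subseteq> E\<close> by (auto simp: tree_sets_def)
  qed
  moreover have "inj_on ?S ?\<Phi>"
  proof (rule inj_onI)
    fix f g assume f: "f \<in> ?\<Phi>" and g: "g \<in> ?\<Phi>" and eq: "?S f = ?S g"
    show "f = g"
    proof (rule PiE_ext[OF f g])
      fix e assume e: "e \<in> B"
      have fe: "f e < a" using f e by auto
      \<comment> \<open>Copies avoid \<open>P\<close>, hence \<open>C\<close>, so the copy chosen by
        \<open>f\<close> must be one chosen by \<open>g\<close>; injectivity of the copies then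
        identifies edge and index.\<close>
      then have "\<rho> e (f e) \<notin> C" using \<rho>_in C(1) B(1) e by blast
      then obtain e' where e': "e' \<in> B" "\<rho> e (f e) = \<rho> e' (g e')" using eq e by blast
      then have "e = e' \<and> f e = g e'"
        using \<rho>_inj[of e "f e" e' "g e'"] B(1) e fe g by auto
      then show "f e = g e" by auto
    qed
  qed
  moreover have "finite (tree_sets V s t E)"
    by (rule finite_subset[of _ "Pow E"]) (use \<open>finite E\<close> in \<open>auto simp: tree_sets_def\<close>)
  ultimately have "card ?\<Phi> \<le> card (tree_sets V s t E)"
    by (intro card_inj_on_le[where f = ?S] image_subsetI)
  then show ?thesis using fin cardB by (simp add: card_PiE)
qed

section \<open>Transport along relabellings\<close>

lemma saturated_image:
  assumes "inj_on \<beta> V" "S \<subseteq> E"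
    and "\<And>e. e \<in> E \<Longrightarrow> s e \<in> V \<and> t e \<in> V"
    and "\<And>e. e \<in> E \<Longrightarrow> s' (\<epsilon> e) = \<beta> (s e) \<and> t' (\<epsilon> e) = \<beta> (t e)"
  shows "saturated (\<beta> ` V) s' t' (\<epsilon> ` S) = (`) \<beta> ` saturated V s t S"
proof -
  have mem: "\<beta> x \<in> \<beta> ` U \<longleftrightarrow> x \<in> U" if "U \<subseteq> V" "x \<in> V" for U x
    using assms(1) that by (auto simp: inj_on_def)
  have "\<beta> ` U \<in> saturated (\<beta> ` V) s' t' (\<epsilon> ` S) \<longleftrightarrow> U \<in> saturated V s t S" if U: "U \<subseteq> V" for U
  proof -
    have "s' (\<epsilon> e) \<in> \<beta> ` U \<longleftrightarrow> s e \<in> U" "t' (\<epsilon> e) \<in> \<beta> ` U \<longleftrightarrow> t e \<in> U" if "e \<in> S" for e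
      using assms(3,4)[of e] mem[OF U] subsetD[OF assms(2) that] by simp_all
    then show ?thesis using U by (auto simp: saturated_def)
  qed
  note iff = this
  show ?thesis
  proof (intro equalityI subsetI)
    fix U' assume U': "U' \<in> saturated (\<beta> ` V) s' t' (\<epsilon> ` S)"
    then obtain U where "U \<subseteq> V" "U' = \<beta> ` U" by (auto simp: saturated_def subset_image_iff)
    then show "U' \<in> (`) \<beta> ` saturated V s t S" using iff U' by blast
  next
    fix U' assume "U' \<in> (`) \<beta> ` saturated V s t S"
    then obtain U where "U \<in> saturated V s t S" "U' = \<beta> ` U" by blast
    then show "U' \<in> saturated (\<beta> ` V) s' t' (\<epsilon> ` S)"
      using iff[of U] by (auto simp: saturated_def)
  qed
qed

text \<open>Makes the count depend only on the incidence pattern, so that graphs on encoded tuples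
  and graphs on orbits are both counted in integer coordinates.\<close>

lemma card_tree_sets_image:
  assumes \<beta>: "inj_on \<beta> V" and \<epsilon>: "inj_on \<epsilon> E"
    and ends: "\<And>e. e \<in> E \<Longrightarrow> s e \<in> V \<and> t e \<in> V"
    and "\<And>e. e \<in> E \<Longrightarrow> s' (\<epsilon> e) = \<beta> (s e) \<and> t' (\<epsilon> e) = \<beta> (t e)"
  shows "card (tree_sets (\<beta> ` V) s' t' (\<epsilon> ` E)) = card (tree_sets V s t E)"
proof -
  have iff: "\<epsilon> ` S \<in> tree_sets (\<beta> ` V) s' t' (\<epsilon> ` E) \<longleftrightarrow> S \<in> tree_sets V s t E" if S: "S \<subseteq> E" for S
  proof -
    have "saturated (\<beta> ` V) s' t' (\<epsilon> ` S) = (`) \<beta> ` saturated V s t S"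
      by (rule saturated_image[OF \<beta> S]) (use assms in auto)
    moreover have "(`) \<beta> ` saturated V s t S = (`) \<beta> ` {{}, V} \<longleftrightarrow> saturated V s t S = {{}, V}"
      by (rule inj_on_image_eq_iff[OF inj_on_image_Pow[OF \<beta>]]) (auto simp: saturated_def)
    ultimately show ?thesis
      using S \<beta> \<epsilon> by (auto simp: tree_sets_def card_image inj_on_subset)
  qed
  have "bij_betw ((`) \<epsilon>) (tree_sets V s t E) (tree_sets (\<beta> ` V) s' t' (\<epsilon> ` E))"
    unfolding bij_betw_def
  proof
    show "inj_on ((`) \<epsilon>) (tree_sets V s t E)"
      by (rule inj_on_subset[OF inj_on_image_Pow[OF \<epsilon>]]) (auto simp: tree_sets_def)
    show "(`) \<epsilon> ` tree_sets V s t E = tree_sets (\<beta> ` V) s' t' (\<epsilon> ` E)"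
    proof (intro equalityI subsetI)
      fix S' assume S': "S' \<in> tree_sets (\<beta> ` V) s' t' (\<epsilon> ` E)"
      then obtain S where "S \<subseteq> E" "S' = \<epsilon> ` S" by (auto simp: tree_sets_def subset_image_iff)
      then show "S' \<in> (`) \<epsilon> ` tree_sets V s t E" using iff S' by blast
    next
      fix S' assume "S' \<in> (`) \<epsilon> ` tree_sets V s t E"
      then obtain S where "S \<in> tree_sets V s t E" "S' = \<epsilon> ` S" by blast
      then show "S' \<in> tree_sets (\<beta> ` V) s' t' (\<epsilon> ` E)"
        using iff[of S] by (auto simp: tree_sets_def)
    qed
  qed
  then show ?thesis by (simp add: bij_betw_same_card)
qed

section \<open>Complexity of an oriented graph\<close>

text \<open>Whichever of the two arcs comes first starts at a vertex where the other ends, so that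
  vertex would be visited twice. The case \<open>f = g\<close> excludes loops. This serves to show
  that a path closed up by one further arc is a circuit.\<close>

lemma (in wf_digraph) apath_no_reversed_arc:
  assumes "apath u p v" "f \<in> set p" "g \<in> set p" "tail G g = head G f" "head G g = tail G f"
  shows False
  using assms
proof (induction p arbitrary: u)
  case (Cons e p)
  have e: "tail G e \<notin> set (awalk_verts (head G e) p)" and p: "apath (head G e) p v"
    using Cons.prems(1) by (auto simp: apath_Cons_iff)
  have ends: "tail G h \<in> set (awalk_verts (head G e) p)" "head G h \<in> set (awalk_verts (head G e) p)"
    if "h \<in> set p" for h
    using that p awalk_verts_arc1 awalk_verts_arc2 by (auto simp: apath_def)
  have hd: "head G e \<in> set (awalk_verts (head G e) p)"
    using p hd_in_awalk_verts by blast
  have "f \<noteq> e"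
  proof
    assume "f = e"
    then show False using Cons.prems(3-5) e hd ends(2)[of g] by (cases "g = e") auto
  qed
  moreover have "g \<noteq> e"
  proof
    assume "g = e"
    then show False using Cons.prems(2,4,5) e hd ends(2)[of f] by (cases "f = e") auto
  qed
  ultimately have "f \<in> set p" "g \<in> set p"
    using Cons.prems(2,3) by auto
  then show ?case using Cons.IH[OF p] Cons.prems by simp
qed simp

text \<open>\<open>E\<close> holds one arc of each pair exchanged by \<open>\<iota>\<close>, so that
  spanning trees, which contain both arcs of each of their edges, correspond to subsets of
  \<open>E\<close>.\<close>

locale oriented_graph = bidirected_digraph G \<iota> + fin_digraph G
  for G :: "('v, 'e) pre_digraph" and \<iota> +
  fixes E :: "'e set"
  assumes orient_Un: "arcs G = E \<union> \<iota> ` E"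
    and orient_disj: "E \<inter> \<iota> ` E = {}"
    and verts_nonempty: "verts G \<noteq> {}"
begin

abbreviation sat :: "'e set \<Rightarrow> 'v set set"
  where "sat S \<equiv> saturated (verts G) (tail G) (head G) S"

section \<open>Reachability and circuits in terms of saturated sets\<close>

definition subgr :: "'e set \<Rightarrow> ('v, 'e) pre_digraph"
  where "subgr S = G\<lparr>arcs := S \<union> \<iota> ` S\<rparr>"

lemma subgr_simps [simp]:
  "verts (subgr S) = verts G" "arcs (subgr S) = S \<union> \<iota> ` S"
  "tail (subgr S) = tail G" "head (subgr S) = head G"
  by (auto simp: subgr_def)

lemma orient_subset: "E \<subseteq> arcs G"
  using orient_Un by blast

lemma ends_E: "e \<in> E \<Longrightarrow> tail G e \<in> verts G \<and> head G e \<in> verts G"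
  using orient_subset by auto

lemma finite_E: "finite E"
  using orient_subset finite_arcs finite_subset by blast

lemma wf_subgr:
  assumes "S \<subseteq> E" shows "wf_digraph (subgr S)"
  using assms orient_subset by unfold_locales auto

lemma spanning_subgr:
  assumes "S \<subseteq> E" shows "spanning (subgr S) G"
  using assms orient_Un wf_subgr[OF assms] wf_digraph
  by (auto simp: spanning_def subgraph_def compatible_def)

lemma sym_subgr:
  assumes "S \<subseteq> E" shows "symmetric (subgr S)"
  unfolding symmetric_conv
proof
  fix e assume "e \<in> arcs (subgr S)"
  then have "e \<in> arcs G" "\<iota> e \<in> arcs (subgr S)" using assms orient_subset by auto
  then show "\<exists>e' \<in> arcs (subgr S). tail (subgr S) e = head (subgr S) e' \<and>
      head (subgr S) e = tail (subgr S) e'"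
    by (intro bexI[of _ "\<iota> e"]) auto
qed

lemma arc_saturated:
  assumes "S \<subseteq> E" "U \<in> sat S" "e \<in> S \<union> \<iota> ` S"
  shows "tail G e \<in> U \<longleftrightarrow> head G e \<in> U"
  using assms orient_subset by (auto simp: saturated_def)

text \<open>The edge set \<open>S\<close> for which \<open>U\<close> is saturated may differ from
  the \<open>S'\<close> in which the walk lives: a circuit with one edge removed is a walk in the
  larger graph that uses only arcs of the smaller one.\<close>

lemma awalk_saturated:
  assumes S: "S \<subseteq> E" and U: "U \<in> sat S" and S': "S' \<subseteq> E"
    and walk: "pre_digraph.awalk (subgr S') u p v" and p: "set p \<subseteq> S \<union> \<iota> ` S"
  shows "u \<in> U \<longleftrightarrow> v \<in> U"
  using walk p
proof (induction p arbitrary: u)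
  case Nil
  then show ?case by (simp add: wf_digraph.awalk_Nil_iff[OF wf_subgr[OF S']])
next
  case (Cons e p)
  then have "u = tail G e" "pre_digraph.awalk (subgr S') (head G e) p v"
    by (simp_all add: wf_digraph.awalk_Cons_iff[OF wf_subgr[OF S']])
  then show ?case using Cons arc_saturated[OF S U] by simp
qed

text \<open>The set of vertices reachable from \<open>u\<close> is itself saturated, because arcs
  can be traversed backwards through \<open>\<iota>\<close>; it is the smallest saturated set
  containing \<open>u\<close>.\<close>

lemma reachable_subgr_iff:
  assumes S: "S \<subseteq> E" and u: "u \<in> verts G" and v: "v \<in> verts G"
  shows "u \<rightarrow>\<^sup>*\<^bsub>subgr S\<^esub> v \<longleftrightarrow> (\<forall>U \<in> sat S. u \<in> U \<longrightarrow> v \<in> U)"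
proof
  interpret S: wf_digraph "subgr S" by (rule wf_subgr[OF S])
  show "\<forall>U \<in> sat S. u \<in> U \<longrightarrow> v \<in> U" if "u \<rightarrow>\<^sup>*\<^bsub>subgr S\<^esub> v"
  proof -
    obtain p where p: "S.awalk u p v" using \<open>u \<rightarrow>\<^sup>*\<^bsub>subgr S\<^esub> v\<close> S.reachable_awalk by auto
    then have "set p \<subseteq> S \<union> \<iota> ` S" by (auto simp: S.awalk_def)
    then show ?thesis using awalk_saturated[OF S _ S p] by auto
  qed
  let ?U = "{w. u \<rightarrow>\<^sup>*\<^bsub>subgr S\<^esub> w}"
  have step: "head G e \<in> ?U" if "tail G e \<in> ?U" "e \<in> S \<union> \<iota> ` S" for e
  proof -
    have "S.awalk (tail G e) [e] (head G e)" using S.arc_implies_awalk[of e] that(2) by simp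
    then show ?thesis using that(1) S.reachable_awalkI S.reachable_trans by blast
  qed
  have "?U \<in> sat S"
    unfolding saturated_def
  proof (intro CollectI conjI ballI subsetI)
    fix w assume "w \<in> ?U"
    then show "w \<in> verts G" using S.reachable_in_verts by auto
  next
    fix e assume e: "e \<in> S"
    then have "e \<in> arcs G" using S orient_subset by auto
    then show "tail G e \<in> ?U \<longleftrightarrow> head G e \<in> ?U"
      using step[of e] step[of "\<iota> e"] e by auto
  qed
  moreover have "u \<in> ?U" using u S.reachable_refl by simp
  ultimately show "u \<rightarrow>\<^sup>*\<^bsub>subgr S\<^esub> v" if "\<forall>U \<in> sat S. u \<in> U \<longrightarrow> v \<in> U"
    using that by blast
qed

lemma connected_subgr_iff:
  assumes S: "S \<subseteq> E"
  shows "Digraph_Component.connected (subgr S) \<longleftrightarrow> sat S = {{}, verts G}"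
proof -
  interpret S: wf_digraph "subgr S" by (rule wf_subgr[OF S])
  have sub: "{{}, verts G} \<subseteq> sat S"
    by (rule trivial_in_saturated) (use S ends_E in auto)
  \<comment> \<open>The subgraph is symmetric, so connectedness amounts to directed reachability
    between all pairs.\<close>
  have "Digraph_Component.connected (subgr S) \<longleftrightarrow>
      (\<forall>u \<in> verts G. \<forall>v \<in> verts G. u \<rightarrow>\<^sup>*\<^bsub>subgr S\<^esub> v)"
    using S.symmetric_connected_imp_strongly_connected[OF sym_subgr[OF S]] verts_nonempty
    by (auto simp: strongly_connected_def connected_def S.reachable_mk_symmetricI)
  also have "\<dots> \<longleftrightarrow> (\<forall>u \<in> verts G. \<forall>v \<in> verts G. \<forall>U \<in> sat S. u \<in> U \<longrightarrow> v \<in> U)"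
    by (intro ball_cong refl reachable_subgr_iff[OF S])
  also have "\<dots> \<longleftrightarrow> sat S \<subseteq> {{}, verts G}"
  proof (intro iffI subsetI ballI impI)
    fix U assume conn: "\<forall>u \<in> verts G. \<forall>v \<in> verts G. \<forall>U \<in> sat S. u \<in> U \<longrightarrow> v \<in> U" and U: "U \<in> sat S"
    then have "U \<subseteq> verts G" by (simp add: saturated_def)
    then show "U \<in> {{}, verts G}" using conn U by blast
  qed blast
  finally show ?thesis using sub by blast
qed

text \<open>An edge lies on a circuit exactly when its ends remain linked after its removal, so
  absence of circuits means that every edge is a bridge, as in
  \<open>acyclic_set_iff_separated\<close>.\<close>

lemma circuit_subgr_iff:
  assumes S: "S \<subseteq> E"
  shows "(\<nexists>p. circuit (subgr S) \<iota> p) \<longleftrightarrow> acyclic_set (verts G) (tail G) (head G) S"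
proof -
  interpret S: wf_digraph "subgr S" by (rule wf_subgr[OF S])
  have sep_iff: "acyclic_set (verts G) (tail G) (head G) S \<longleftrightarrow>
    (\<forall>e \<in> S. \<exists>U \<in> sat (S - {e}). (tail G e \<in> U) \<noteq> (head G e \<in> U))"
    by (rule acyclic_set_iff_separated) (use S ends_E finite_subset[OF S finite_E] in auto)
  show ?thesis
    unfolding sep_iff
  proof (intro iffI ballI notI)
    fix e assume nocirc: "\<nexists>p. circuit (subgr S) \<iota> p" and e: "e \<in> S"
    have S': "S - {e} \<subseteq> E" using S by auto
    interpret S': wf_digraph "subgr (S - {e})" by (rule wf_subgr[OF S'])
    have eE: "e \<in> E" "e \<in> arcs G" using e S orient_subset by auto
    show "\<exists>U \<in> sat (S - {e}). (tail G e \<in> U) \<noteq> (head G e \<in> U)"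
    proof (rule ccontr)
      assume "\<not> ?thesis"
      then have "head G e \<rightarrow>\<^sup>*\<^bsub>subgr (S - {e})\<^esub> tail G e"
        using reachable_subgr_iff[OF S', of "head G e" "tail G e"] eE ends_E by auto
      \<comment> \<open>A path rather than a walk, so that closing it up with \<open>e\<close>
        repeats no vertex.\<close>
      then obtain p where p: "S'.apath (head G e) p (tail G e)"
        using S'.reachable_apath by auto
      have pS: "set p \<subseteq> (S - {e}) \<union> \<iota> ` (S - {e})"
        using p by (auto simp: S'.apath_def S'.awalk_def)
      \<comment> \<open>Both notions depend only on tails and heads, which all the subgraphs
        \<open>subgr\<close> share.\<close>
      have cas: "S.cas u q v = S'.cas u q v" for u q v
        by (induction q arbitrary: u) (auto simp: S.cas.simps S'.cas.simps)
      have averts: "S.awalk_verts u q = S'.awalk_verts u q" for u q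
        by (induction q arbitrary: u) (auto simp: S.awalk_verts.simps S'.awalk_verts.simps)
      have "S.awalk (head G e) p (tail G e)"
        using p pS by (auto simp: S'.apath_def S.awalk_def S'.awalk_def cas)
      then have "S.awalk (tail G e) (e # p) (tail G e)"
        using e by (simp add: S.awalk_Cons_iff)
      moreover have "distinct (tl (S.awalk_verts (tail G e) (e # p)))"
        using p by (simp add: S'.apath_def averts)
      ultimately have "S.cycle (e # p)" by (auto simp: S.cycle_def)
      \<comment> \<open>Inside \<open>p\<close> a reversed pair is impossible on a path, and neither
        \<open>e\<close> nor \<open>\<iota> e\<close> is an arc of
        \<open>subgr (S - {e})\<close>.\<close>
      moreover have "\<iota> f \<notin> set (e # p)" if "f \<in> set (e # p)" for f
      proof -
        have "\<iota> f \<notin> set p" if "f \<in> set p"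
        proof
          assume "\<iota> f \<in> set p"
          have "f \<in> arcs G" using that pS S orient_Un by blast
          then show False
            using S'.apath_no_reversed_arc[OF p that \<open>\<iota> f \<in> set p\<close>] by simp
        qed
        moreover have "e \<notin> set p"
          using pS eE(1) S orient_disj by blast
        moreover have "\<iota> e \<notin> S - {e}" "\<iota> e \<notin> \<iota> ` (S - {e})"
          using eE(1) S orient_disj by (blast, auto simp: arev_eq_iff)
        then have "\<iota> e \<notin> set p" using pS by blast
        moreover have "\<iota> e \<noteq> e" using arev_neq eE(2) .
        ultimately show ?thesis using that by (metis arev_arev set_ConsD)
      qed
      ultimately show False using nocirc by (auto simp: circuit_def)
    qed
  next
    assume sep: "\<forall>e \<in> S. \<exists>U \<in> sat (S - {e}). (tail G e \<in> U) \<noteq> (head G e \<in> U)"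
    assume "\<exists>p. circuit (subgr S) \<iota> p"
    then obtain p where cyc: "S.cycle p" and norev: "\<forall>f \<in> set p. \<iota> f \<notin> set p"
      by (auto simp: circuit_def)
    \<comment> \<open>Cutting the circuit open at its first arc \<open>f\<close> leaves a walk
      \<open>q\<close> between the ends of \<open>f\<close>. It avoids \<open>f\<close> by
      distinctness and \<open>\<iota> f\<close> by the circuit condition, so no saturated set of
      \<open>S - {e}\<close> separates these ends.\<close>
    then obtain f q where p: "p = f # q" by (cases p) (auto simp: S.cycle_def)
    have "S.awalk (tail G f) (f # q) (tail G f)" "distinct (f # q)"
      using cyc S.cycle_conv p by (auto simp: S.awalk_Cons_iff)
    then have f: "f \<in> S \<union> \<iota> ` S" and q: "S.awalk (head G f) q (tail G f)" "f \<notin> set q"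
      by (auto simp: S.awalk_Cons_iff)
    have qS: "set q \<subseteq> S \<union> \<iota> ` S" using q(1) by (auto simp: S.awalk_def)
    have rev: "\<iota> f \<notin> set q" using norev p by simp
    obtain e where e: "e \<in> S" "f = e \<or> f = \<iota> e" using f by auto
    have "set q \<subseteq> (S - {e}) \<union> \<iota> ` (S - {e})"
      using qS q(2) rev e(2) by auto
    then have linked: "head G f \<in> U \<longleftrightarrow> tail G f \<in> U" if "U \<in> sat (S - {e})" for U
      using awalk_saturated[OF _ that S q(1)] S by blast
    obtain U where U: "U \<in> sat (S - {e})" "(tail G e \<in> U) \<noteq> (head G e \<in> U)"
      using sep e(1) by blast
    have "e \<in> arcs G" using e(1) S orient_subset by auto
    then have "(tail G f \<in> U) \<noteq> (head G f \<in> U)"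
      using e(2) U(2) by (elim disjE) simp_all
    then show False using linked[OF U(1)] by blast
  qed
qed

section \<open>Spanning trees as edge subsets\<close>

lemma spanning_trees_eq:
  "spanning_trees G \<iota> = subgr ` tree_sets (verts G) (tail G) (head G) E"
proof (intro equalityI subsetI)
  have iff: "Digraph_Component.connected (subgr S) \<and> (\<nexists>p. circuit (subgr S) \<iota> p) \<longleftrightarrow>
      sat S = {{}, verts G} \<and> card S + 1 = card (verts G)" if "S \<subseteq> E" for S
    unfolding connected_subgr_iff[OF that] circuit_subgr_iff[OF that]
    by (intro conj_cong refl acyclic_set_if_spanning finite_verts verts_nonempty
        finite_subset[OF that finite_E])
  {
    fix T assume "T \<in> spanning_trees G \<iota>"
    then have T: "spanning T G" "\<iota> ` arcs T \<subseteq> arcs T"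
      "Digraph_Component.connected T" "\<nexists>p. circuit T \<iota> p"
      by (auto simp: spanning_trees_def)
    \<comment> \<open>Closure of \<open>arcs T\<close> under \<open>\<iota>\<close> makes them
      recoverable from those lying in \<open>E\<close>.\<close>
    define S where "S = arcs T \<inter> E"
    have sub: "arcs T \<subseteq> arcs G" using T(1) by (auto simp: spanning_def subgraph_def)
    have "arcs T = S \<union> \<iota> ` S"
    proof (intro equalityI subsetI)
      fix e assume e: "e \<in> arcs T"
      then consider "e \<in> E" | e' where "e' \<in> E" "e = \<iota> e'" using sub orient_Un by blast
      then show "e \<in> S \<union> \<iota> ` S"
      proof cases
        case 2
        then have "e' \<in> arcs T" using T(2) e by (metis arev_arev image_subset_iff)
        then show ?thesis using 2 by (auto simp: S_def)
      qed (use e in \<open>auto simp: S_def\<close>)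
    qed (use T(2) in \<open>auto simp: S_def\<close>)
    then have eq: "T = subgr S"
      using T(1) by (simp add: spanning_def subgraph_def compatible_def)
    moreover have "S \<subseteq> E" by (auto simp: S_def)
    ultimately have "S \<in> tree_sets (verts G) (tail G) (head G) E"
      using iff[of S] T(3,4) by (simp add: tree_sets_def)
    then show "T \<in> subgr ` tree_sets (verts G) (tail G) (head G) E" using eq by blast
  next
    fix T assume "T \<in> subgr ` tree_sets (verts G) (tail G) (head G) E"
    then obtain S where S: "T = subgr S" "S \<subseteq> E" "sat S = {{}, verts G}" "card S + 1 = card (verts G)"
      by (auto simp: tree_sets_def)
    then show "T \<in> spanning_trees G \<iota>"
      using iff[OF S(2)] spanning_subgr[OF S(2)]
      by (simp add: spanning_trees_def image_Un image_image Un_commute)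
  }
qed

text \<open>\<open>subgr\<close> is injective on subsets of \<open>E\<close>, since \<open>S\<close>
  is recovered by intersecting the arcs with \<open>E\<close>.\<close>

lemma complexity_eq: "complexity G \<iota> = card (tree_sets (verts G) (tail G) (head G) E)"
proof -
  have inter: "arcs (subgr S) \<inter> E = S" if "S \<subseteq> E" for S
  proof -
    have "\<iota> ` S \<inter> E = {}" using orient_disj image_mono[OF that, of \<iota>] by blast
    then show ?thesis using that by (simp add: Int_Un_distrib2 Int_absorb2)
  qed
  have "inj_on subgr (tree_sets (verts G) (tail G) (head G) E)"
  proof (rule inj_onI)
    fix S S' assume "S \<in> tree_sets (verts G) (tail G) (head G) E"
      "S' \<in> tree_sets (verts G) (tail G) (head G) E" "subgr S = subgr S'"
    then show "S = S'" using inter[of S] inter[of S'] by (simp add: tree_sets_def)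
  qed
  then show ?thesis
    by (simp add: complexity_def spanning_trees_eq card_image)
qed

lemma connected_iff_saturated: "Digraph_Component.connected G \<longleftrightarrow> sat E = {{}, verts G}"
proof -
  have "subgr E = G" using orient_Un by (simp add: subgr_def)
  then show ?thesis using connected_subgr_iff[of E] by simp
qed

end

section \<open>Dipoles\<close>

text \<open>
  The flag of a vertex \<open>(x, b)\<close> tells whether it lies above \<open>u\<close> or \<open>v\<close>, and the flag of an arc
  \<open>(x, j, b)\<close> is that of its origin \<open>(x, b)\<close>; its terminus is \<open>(far N w x j b, \<not> b)\<close>.
\<close>

definition far :: "int \<Rightarrow> (nat \<Rightarrow> int) \<Rightarrow> int \<Rightarrow> nat \<Rightarrow> bool \<Rightarrow> int"
  where "far N w x j b = (if b then x - w j else x + w j) mod N"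

lemma far_bounds: "0 < N \<Longrightarrow> 0 \<le> far N w x j b \<and> far N w x j b < N"
  by (simp add: far_def)

lemma far_far: "far N w (far N w x j b) j (\<not> b) = x mod N"
  by (simp add: far_def mod_simps)

lemma far_mod: "e dvd N \<Longrightarrow> far N w x j b mod e = far e w (x mod e) j b"
  by (simp add: far_def mod_mod_cancel mod_simps)

lemma far_add: "far N w ((x + i) mod N) j b = (far N w x j b + i) mod N"
  by (simp add: far_def mod_simps algebra_simps)

section \<open>Components of the derived dipoles\<close>

abbreviation dipole_verts :: "int \<Rightarrow> (int \<times> bool) set"
  where "dipole_verts N \<equiv> {0..<N} \<times> UNIV"

text \<open>Only the arcs with flag \<open>False\<close> are listed, so an undirected edge is just a
  pair \<open>(x, j)\<close>.\<close>

abbreviation dipole_tail :: "int \<times> nat \<Rightarrow> int \<times> bool"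
  where "dipole_tail \<equiv> \<lambda>(x, j). (x, False)"

abbreviation dipole_head :: "int \<Rightarrow> (nat \<Rightarrow> int) \<Rightarrow> int \<times> nat \<Rightarrow> int \<times> bool"
  where "dipole_head N w \<equiv> \<lambda>(x, j). ((x + w j) mod N, True)"

lemma dipole_ends:
  "0 < N \<Longrightarrow> f \<in> {0..<N} \<times> J \<Longrightarrow> dipole_tail f \<in> dipole_verts N \<and> dipole_head N w f \<in> dipole_verts N"
  by (auto split: prod.splits)

text \<open>Invariance under the shift by \<open>c\<close> modulo \<open>N\<close> extends to all
  integer multiples of \<open>c\<close>; by Bezout one of them carries \<open>x\<close> to its
  residue modulo \<open>gcd N c\<close>.\<close>

lemma shift_invariant_mod_gcd:
  fixes N c x :: int
  assumes "0 < N" and inv: "\<And>x. x \<in> {0..<N} \<Longrightarrow> x \<in> A \<longleftrightarrow> (x + c) mod N \<in> A"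
    and x: "x \<in> {0..<N}"
  shows "x \<in> A \<longleftrightarrow> x mod gcd N c \<in> A"
proof -
  have inv': "(y + c) mod N \<in> A \<longleftrightarrow> y mod N \<in> A" for y
    using inv[of "y mod N"] \<open>0 < N\<close> by (simp add: mod_simps)
  have mult: "(y + k * c) mod N \<in> A \<longleftrightarrow> y mod N \<in> A" for y k
  proof (induction k rule: int_induct[where k = 0])
    case (step1 i)
    then show ?case using inv'[of "y + i * c"] by (simp add: algebra_simps)
  next
    case (step2 i)
    then show ?case using inv'[of "y + (i - 1) * c"] by (simp add: algebra_simps)
  qed simp
  obtain u v where uv: "u * N + v * c = gcd N c" using bezout_int by blast
  \<comment> \<open>Subtracting \<open>?q\<close> copies of the gcd reduces \<open>x\<close>; each
    copy is \<open>v * c\<close> up to a multiple of \<open>N\<close>, whence the factor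
    \<open>- ?q * v\<close>.\<close>
  let ?q = "x div gcd N c"
  have "x + (- ?q * v) * c = x - ?q * gcd N c + (?q * u) * N"
    by (simp add: uv[symmetric] algebra_simps)
  also have "x - ?q * gcd N c = x mod gcd N c"
    by (simp add: minus_div_mult_eq_mod)
  finally have "(x + (- ?q * v) * c) mod N = (x mod gcd N c) mod N"
    by simp
  moreover have "(x mod gcd N c) mod N = x mod gcd N c"
  proof (rule mod_pos_pos_trivial)
    have "x mod gcd N c < gcd N c" using \<open>0 < N\<close> by simp
    also have "\<dots> \<le> N" using \<open>0 < N\<close> by (simp add: zdvd_imp_le)
    finally show "x mod gcd N c < N" .
  qed (use \<open>0 < N\<close> in simp)
  ultimately show ?thesis using mult[of x "- ?q * v"] x by simp
qed

text \<open>Edges of voltage 0 force the two levels of \<open>U\<close> to agree, and edges of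
  voltage \<open>c\<close> make the common level invariant under the shift by \<open>c\<close>. So
  the components are the residue classes modulo \<open>gcd N c\<close>, each taken in both
  levels.\<close>

lemma saturated_dipole:
  assumes N: "0 < N" and j: "p \<in> J" "w p = 0" "q \<in> J" "w q = c"
    and J: "\<And>j. j \<in> J \<Longrightarrow> w j = 0 \<or> w j = c"
  shows "saturated (dipole_verts N) dipole_tail (dipole_head N w) ({0..<N} \<times> J)
    = (\<lambda>W. {x \<in> {0..<N}. x mod gcd N c \<in> W} \<times> UNIV) ` Pow {0..<gcd N c}"
proof (intro equalityI subsetI)
  fix U assume U: "U \<in> saturated (dipole_verts N) dipole_tail (dipole_head N w) ({0..<N} \<times> J)"
  then have sub: "U \<subseteq> dipole_verts N" by (simp add: saturated_def)
  have link: "(x, False) \<in> U \<longleftrightarrow> ((x + w j) mod N, True) \<in> U" if "x \<in> {0..<N}" "j \<in> J" for x j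
    using U that by (auto simp: saturated_def)
  define A where "A = {x. (x, False) \<in> U}"
  have TF: "(x, True) \<in> U \<longleftrightarrow> x \<in> A" if "x \<in> {0..<N}" for x
    using link[OF that j(1)] j(2) that by (simp add: A_def)
  have memA: "x \<in> A \<longleftrightarrow> x mod gcd N c \<in> A" if x: "x \<in> {0..<N}" for x
  proof (rule shift_invariant_mod_gcd[OF N _ x])
    fix y assume y: "y \<in> {0..<N}"
    have "(y + c) mod N \<in> {0..<N}" using N by simp
    then show "y \<in> A \<longleftrightarrow> (y + c) mod N \<in> A"
      using link[OF y j(3)] TF j(4) by (simp add: A_def)
  qed
  have "U = {x \<in> {0..<N}. x mod gcd N c \<in> A \<inter> {0..<gcd N c}} \<times> UNIV"
  proof (rule Set.set_eqI)
    fix z :: "int \<times> bool"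
    obtain x b where z: "z = (x, b)" by (cases z)
    show "z \<in> U \<longleftrightarrow> z \<in> {x \<in> {0..<N}. x mod gcd N c \<in> A \<inter> {0..<gcd N c}} \<times> UNIV"
    proof (cases "x \<in> {0..<N}")
      case True
      then have "z \<in> U \<longleftrightarrow> x \<in> A" using TF z by (cases b) (auto simp: A_def)
      then show ?thesis using memA[OF True] True z N by auto
    qed (use sub z in auto)
  qed
  then show "U \<in> (\<lambda>W. {x \<in> {0..<N}. x mod gcd N c \<in> W} \<times> UNIV) ` Pow {0..<gcd N c}"
    by blast
next
  fix U :: "(int \<times> bool) set"
  assume "U \<in> (\<lambda>W. {x \<in> {0..<N}. x mod gcd N c \<in> W} \<times> UNIV) ` Pow {0..<gcd N c}"
  then obtain W where U: "U = {x \<in> {0..<N}. x mod gcd N c \<in> W} \<times> UNIV" by blast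
  have "(x + w j) mod N mod gcd N c = x mod gcd N c" if "j \<in> J" for x j
  proof -
    have "gcd N c dvd w j" using J[OF that] by auto
    then have "(x + w j) mod gcd N c = x mod gcd N c" by (auto elim!: dvdE)
    then show ?thesis by (simp add: mod_mod_cancel)
  qed
  then show "U \<in> saturated (dipole_verts N) dipole_tail (dipole_head N w) ({0..<N} \<times> J)"
    using N by (auto simp: U saturated_def)
qed

lemma card_saturated_dipole:
  assumes "0 < N" "p \<in> J" "w p = 0" "q \<in> J" "w q = c"
    and "\<And>j. j \<in> J \<Longrightarrow> w j = 0 \<or> w j = c"
  shows "card (saturated (dipole_verts N) dipole_tail (dipole_head N w) ({0..<N} \<times> J))
    = 2 ^ nat (gcd N c)"
proof -
  have g: "gcd N c \<le> N" using assms(1) by (simp add: zdvd_imp_le)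
  have "inj_on (\<lambda>W. {x \<in> {0..<N}. x mod gcd N c \<in> W} \<times> (UNIV :: bool set)) (Pow {0..<gcd N c})"
  proof (rule inj_onI)
    fix W W' assume W: "W \<in> Pow {0..<gcd N c}" "W' \<in> Pow {0..<gcd N c}"
      and "{x \<in> {0..<N}. x mod gcd N c \<in> W} \<times> (UNIV :: bool set)
        = {x \<in> {0..<N}. x mod gcd N c \<in> W'} \<times> UNIV"
    then have eq: "{x \<in> {0..<N}. x mod gcd N c \<in> W} = {x \<in> {0..<N}. x mod gcd N c \<in> W'}"
      by (simp add: times_eq_iff) blast
    have mem: "x \<in> W \<longleftrightarrow> x \<in> {x \<in> {0..<N}. x mod gcd N c \<in> W}" if "x \<in> {0..<gcd N c}" for x W
      using that g by auto
    have "x \<in> W \<longleftrightarrow> x \<in> W'" if "x \<in> {0..<gcd N c}" for x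
      using mem[OF that, of W] mem[OF that, of W'] eq by argo
    then show "W = W'" using W by blast
  qed
  then show ?thesis
    by (subst saturated_dipole[OF assms]) (simp_all add: card_image card_Pow)
qed

text \<open>The edges above \<open>p\<close> and \<open>q\<close> suffice: they are the preceding
  case with \<open>c = 1\<close>, where \<open>gcd N 1 = 1\<close> leaves a single
  component.\<close>

lemma saturated_dipole_trivial:
  assumes N: "0 < N" and j: "p \<in> J" "w p = 0" "q \<in> J" "w q = 1"
  shows "saturated (dipole_verts N) dipole_tail (dipole_head N w) ({0..<N} \<times> J) = {{}, dipole_verts N}"
proof -
  have "saturated (dipole_verts N) dipole_tail (dipole_head N w) ({0..<N} \<times> J)
      \<subseteq> saturated (dipole_verts N) dipole_tail (dipole_head N w) ({0..<N} \<times> {p, q})"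
    by (rule saturated_antimono) (use j in auto)
  also have "\<dots> = (\<lambda>W. {x \<in> {0..<N}. x mod gcd N 1 \<in> W} \<times> UNIV) ` Pow {0..<gcd N 1}"
    by (rule saturated_dipole[where p = p and q = q]) (use N j in auto)
  also have "{0..<gcd N 1} = {0::int}" by auto
  also have "(\<lambda>W. {x \<in> {0..<N}. x mod gcd N 1 \<in> W} \<times> (UNIV :: bool set)) ` Pow {0}
      = {{}, dipole_verts N}"
    by (auto simp: Pow_insert)
  finally show ?thesis
    using trivial_in_saturated[of "{0..<N} \<times> J" dipole_tail "dipole_verts N" "dipole_head N w"]
      dipole_ends[OF N] by blast
qed

section \<open>The test family and its tree counts\<close>

definition family_voltage :: "nat \<Rightarrow> int \<Rightarrow> nat \<Rightarrow> int"
  where "family_voltage a c j = (if j = 0 then 1 else if j \<le> a then 0 else c)"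

definition family_trees :: "int \<Rightarrow> int \<Rightarrow> nat \<Rightarrow> nat"
  where "family_trees N c a = card (tree_sets (dipole_verts N) dipole_tail
    (dipole_head N (family_voltage a c)) ({0..<N} \<times> {0..2 * a}))"

text \<open>Rank of the subgraph of edges of voltage 0 and \<open>c\<close>: number of vertices
  minus number of components.\<close>

definition family_rank :: "int \<Rightarrow> int \<Rightarrow> nat"
  where "family_rank N c = nat (2 * N - gcd N c)"

lemma family_rank:
  assumes "0 < N"
  shows "2 ^ nat (gcd N c) * 2 ^ family_rank N c = (2::nat) ^ card (dipole_verts N)"
proof -
  have "gcd N c \<le> N" using assms by (simp add: zdvd_imp_le)
  moreover have "card (dipole_verts N) = 2 * nat N" by (simp add: card_cartesian_product)
  ultimately have "nat (gcd N c) + family_rank N c = card (dipole_verts N)"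
    using assms gcd_ge_0_int[of N c] unfolding family_rank_def by linarith
  then show ?thesis by (simp flip: power_add)
qed

text \<open>The \<open>N\<close> edges above the edge of voltage 1 form the part \<open>P\<close>
  independent of \<open>a\<close>; all others form \<open>F\<close>.\<close>

lemma family_trees_le:
  assumes N: "0 < N" and a: "0 < a"
  shows "family_trees N c a \<le> 2 ^ nat N * (nat N * (2 * a) + 1) ^ family_rank N c"
proof -
  let ?w = "family_voltage a c"
  let ?P = "{0..<N} \<times> {0::nat}" and ?F = "{0..<N} \<times> {1..2 * a}"
  have "card (saturated (dipole_verts N) dipole_tail (dipole_head N ?w) ?F) = 2 ^ nat (gcd N c)"
    by (rule card_saturated_dipole[where p = 1 and q = "2 * a"])
      (use N a in \<open>auto simp: family_voltage_def\<close>)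
  then have "card (saturated (dipole_verts N) dipole_tail (dipole_head N ?w) ?F) * 2 ^ family_rank N c
      = 2 ^ card (dipole_verts N)"
    using family_rank[OF N] by simp
  then have "card (tree_sets (dipole_verts N) dipole_tail (dipole_head N ?w) (?P \<union> ?F))
      \<le> 2 ^ card ?P * (card ?F + 1) ^ family_rank N c"
    by (intro card_tree_sets_le dipole_ends[OF N, where J = "{0..2 * a}"]) (use N in auto)
  moreover have "?P \<union> ?F = {0..<N} \<times> {0..2 * a}" by auto
  ultimately show ?thesis by (simp add: family_trees_def card_cartesian_product)
qed

lemma family_trees_ge:
  assumes N: "0 < N" and a: "0 < a"
  shows "a ^ family_rank N c \<le> family_trees N c a"
  unfolding family_trees_def
\<comment> \<open>The last index of each block represents it: \<open>a\<close> for voltage 0 and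
  \<open>2 * a\<close> for voltage \<open>c\<close>. Subtracting \<open>i < a\<close> runs through
  \<open>1..a\<close> or \<open>a + 1..2 * a\<close> and never hits the index 0 of
  \<open>P\<close>.\<close>
proof (rule card_tree_sets_ge[where P = "{0..<N} \<times> {0}" and R = "{0..<N} \<times> {a, 2 * a}"
      and \<rho> = "\<lambda>(x, j) i. (x, j - i)"])
  let ?w = "family_voltage a c"
  have "card (saturated (dipole_verts N) dipole_tail (dipole_head N ?w) ({0..<N} \<times> {a, 2 * a})) = 2 ^ nat (gcd N c)"
    by (rule card_saturated_dipole[where p = a and q = "2 * a"])
      (use N a in \<open>auto simp: family_voltage_def\<close>)
  then show "card (saturated (dipole_verts N) dipole_tail (dipole_head N ?w) ({0..<N} \<times> {a, 2 * a}))
      * 2 ^ family_rank N c = 2 ^ card (dipole_verts N)"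
    using family_rank[OF N] by simp
  \<comment> \<open>The edges of voltages 1 and 0 alone connect the graph, whatever \<open>c\<close>
    is.\<close>
  have "{0..<N} \<times> {0} \<union> {0..<N} \<times> {a, 2 * a} = {0..<N} \<times> {0, a, 2 * a}" by auto
  then show "saturated (dipole_verts N) dipole_tail (dipole_head N ?w)
      ({0..<N} \<times> {0} \<union> {0..<N} \<times> {a, 2 * a}) = {{}, dipole_verts N}"
    using saturated_dipole_trivial[OF N, of a "{0, a, 2 * a}" ?w 0] a
    by (simp add: family_voltage_def)
next
  fix f assume "f \<in> {0..<N} \<times> {0} \<union> {0..<N} \<times> {a, 2 * a}"
  then show "dipole_tail f \<in> dipole_verts N \<and> dipole_head N (family_voltage a c) f \<in> dipole_verts N"
    using dipole_ends[OF N, of f UNIV] by blast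
next
  fix e i assume "e \<in> {0..<N} \<times> {a, 2 * a}" "i < a"
  then show "dipole_tail ((\<lambda>(x, j) i. (x, j - i)) e i) = dipole_tail e \<and>
      dipole_head N (family_voltage a c) ((\<lambda>(x, j) i. (x, j - i)) e i) =
      dipole_head N (family_voltage a c) e"
    using a by (auto simp: family_voltage_def)
qed (use N a in auto)

text \<open>\<open>\<beta>\<close> and \<open>\<epsilon>\<close> are coordinates identifying
  \<open>Q\<close> with the derived dipole over the integers modulo \<open>N\<close>. This covers
  both the graphs on encoded tuples and the quotients, whose vertices and edges are orbits.\<close>

locale dipole_graph =
  fixes N :: int and J :: "nat set" and w :: "nat \<Rightarrow> int"
    and \<beta> :: "int \<times> bool \<Rightarrow> 'v" and \<epsilon> :: "int \<times> nat \<times> bool \<Rightarrow> 'e"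
    and Q :: "('v, 'e) pre_digraph" and \<iota> :: "'e \<Rightarrow> 'e"
  assumes N: "0 < N" and finite_J: "finite J"
    and inj_\<beta>: "inj_on \<beta> (dipole_verts N)" and inj_\<epsilon>: "inj_on \<epsilon> ({0..<N} \<times> J \<times> UNIV)"
    and verts_Q: "verts Q = \<beta> ` dipole_verts N" and arcs_Q: "arcs Q = \<epsilon> ` ({0..<N} \<times> J \<times> UNIV)"
    and tail_\<epsilon>: "\<And>x j b. x \<in> {0..<N} \<Longrightarrow> j \<in> J \<Longrightarrow> tail Q (\<epsilon> (x, j, b)) = \<beta> (x, b)"
    and head_\<epsilon>: "\<And>x j b. x \<in> {0..<N} \<Longrightarrow> j \<in> J \<Longrightarrow> head Q (\<epsilon> (x, j, b)) = \<beta> (far N w x j b, \<not> b)"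
    and rev_\<epsilon>: "\<And>x j b. x \<in> {0..<N} \<Longrightarrow> j \<in> J \<Longrightarrow> \<iota> (\<epsilon> (x, j, b)) = \<epsilon> (far N w x j b, j, \<not> b)"
    and rev_outside: "\<And>e. e \<notin> arcs Q \<Longrightarrow> \<iota> e = e"
begin

lemma far_in: "far N w x j b \<in> {0..<N}"
  using far_bounds[OF N] by simp

lemma arc_cases:
  assumes "e \<in> arcs Q"
  obtains x j b where "x \<in> {0..<N}" "j \<in> J" "e = \<epsilon> (x, j, b)"
  using assms by (auto simp: arcs_Q)

lemma \<epsilon>_eq_iff:
  "\<lbrakk>x \<in> {0..<N}; j \<in> J; x' \<in> {0..<N}; j' \<in> J\<rbrakk> \<Longrightarrow>
    \<epsilon> (x, j, b) = \<epsilon> (x', j', b') \<longleftrightarrow> x = x' \<and> j = j' \<and> b = b'"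
  using inj_on_eq_iff[OF inj_\<epsilon>, of "(x, j, b)" "(x', j', b')"] by simp

lemma fin_digraph: "fin_digraph Q"
proof
  show "tail Q e \<in> verts Q" if "e \<in> arcs Q" for e
    using that by (rule arc_cases) (auto simp: tail_\<epsilon> verts_Q)
  show "head Q e \<in> verts Q" if "e \<in> arcs Q" for e
    using that by (rule arc_cases) (use far_in in \<open>auto simp: head_\<epsilon> verts_Q\<close>)
qed (use finite_J in \<open>auto simp: verts_Q arcs_Q\<close>)

lemma bidirected: "bidirected_digraph Q \<iota>"
proof -
  interpret fin_digraph Q by (rule fin_digraph)
  show ?thesis
  proof (rule bidirected_digraphI)
    fix e assume "e \<in> arcs Q"
    then obtain x j b where e: "x \<in> {0..<N}" "j \<in> J" "e = \<epsilon> (x, j, b)" by (rule arc_cases)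
    show "\<iota> e \<noteq> e" using e far_in by (simp add: rev_\<epsilon> \<epsilon>_eq_iff)
    show "\<iota> (\<iota> e) = e" using e far_in[of x j b] far_far[of N w x j b] by (simp add: rev_\<epsilon>)
    show "tail Q (\<iota> e) = head Q e" using e far_in[of x j b] by (simp add: rev_\<epsilon> tail_\<epsilon> head_\<epsilon>)
  qed (rule rev_outside)
qed

lemma arcs_oriented:
  fixes E
  defines "E \<equiv> (\<lambda>(x, j). \<epsilon> (x, j, False)) ` ({0..<N} \<times> J)"
  shows "arcs Q = E \<union> \<iota> ` E" and "E \<inter> \<iota> ` E = {}"
proof -
  interpret bidirected_digraph Q \<iota> by (rule bidirected)
  have EI: "\<epsilon> (x, j, False) \<in> E" if "x \<in> {0..<N}" "j \<in> J" for x j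
    unfolding E_def by (rule image_eqI[of _ _ "(x, j)"]) (use that in auto)
  have E_arcs: "E \<subseteq> arcs Q"
    unfolding E_def by (auto simp: arcs_Q)
  show "arcs Q = E \<union> \<iota> ` E"
  proof (intro equalityI subsetI)
    fix e assume "e \<in> arcs Q"
    then obtain x j b where e: "x \<in> {0..<N}" "j \<in> J" "e = \<epsilon> (x, j, b)" by (rule arc_cases)
    show "e \<in> E \<union> \<iota> ` E"
    proof (cases b)
      case True
      then have "\<iota> e \<in> E" using e EI[OF far_in e(2)] by (simp add: rev_\<epsilon>)
      then have "\<iota> (\<iota> e) \<in> \<iota> ` E" by (rule imageI)
      then show ?thesis by simp
    qed (use e EI in auto)
  next
    fix e assume "e \<in> E \<union> \<iota> ` E"
    then show "e \<in> arcs Q" using E_arcs by auto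
  qed
  show "E \<inter> \<iota> ` E = {}"
    unfolding E_def using far_in by (auto simp: rev_\<epsilon> \<epsilon>_eq_iff)
qed

sublocale oriented_graph Q \<iota> "(\<lambda>(x, j). \<epsilon> (x, j, False)) ` ({0..<N} \<times> J)"
proof -
  interpret bidirected_digraph Q \<iota> by (rule bidirected)
  interpret fin_digraph Q by (rule fin_digraph)
  show "oriented_graph Q \<iota> ((\<lambda>(x, j). \<epsilon> (x, j, False)) ` ({0..<N} \<times> J))"
    by unfold_locales (use arcs_oriented N in \<open>auto simp: verts_Q\<close>)
qed

lemma inj_oriented: "inj_on (\<lambda>(x, j). \<epsilon> (x, j, False)) ({0..<N} \<times> J)"
  by (rule inj_onI) (auto simp: \<epsilon>_eq_iff)

lemma oriented_ends:
  assumes "f \<in> {0..<N} \<times> J"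
  shows "tail Q ((\<lambda>(x, j). \<epsilon> (x, j, False)) f) = \<beta> (dipole_tail f) \<and>
    head Q ((\<lambda>(x, j). \<epsilon> (x, j, False)) f) = \<beta> (dipole_head N w f)"
  using assms by (auto simp: tail_\<epsilon> head_\<epsilon> far_def)

lemma complexity_dipole:
  "complexity Q \<iota> = card (tree_sets (dipole_verts N) dipole_tail (dipole_head N w) ({0..<N} \<times> J))"
  unfolding complexity_eq verts_Q
  by (rule card_tree_sets_image[where s = dipole_tail and t = "dipole_head N w", OF inj_\<beta> inj_oriented dipole_ends[OF N] oriented_ends])

lemma connected_dipole:
  assumes "p \<in> J" "w p = 0" "q \<in> J" "w q = 1"
  shows "Digraph_Component.connected Q"
proof -
  have "sat ((\<lambda>(x, j). \<epsilon> (x, j, False)) ` ({0..<N} \<times> J)) =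
      (`) \<beta> ` saturated (dipole_verts N) dipole_tail (dipole_head N w) ({0..<N} \<times> J)"
    unfolding verts_Q
    by (rule saturated_image[where E = "{0..<N} \<times> J" and \<epsilon> = "\<lambda>(x, j). \<epsilon> (x, j, False)" and s = dipole_tail and t = "dipole_head N w", OF inj_\<beta> subset_refl dipole_ends[OF N] oriented_ends])
  then show ?thesis
    using saturated_dipole_trivial[OF N assms] by (simp add: connected_iff_saturated verts_Q)
qed

end

section \<open>Cyclic covers of dipoles\<close>

text \<open>Vertices and edges have to be natural numbers, so index tuples are encoded.\<close>

definition encoded :: "('a::countable \<Rightarrow> 'b::countable) \<Rightarrow> nat \<Rightarrow> nat"
  where "encoded f n = to_nat (f (from_nat n))"

lemma encoded_to_nat [simp]: "encoded f (to_nat x) = to_nat (f x)"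
  by (simp add: encoded_def)

abbreviation dipole_arcs :: "int \<Rightarrow> nat set \<Rightarrow> (int \<times> nat \<times> bool) set"
  where "dipole_arcs N J \<equiv> {0..<N} \<times> J \<times> UNIV"

text \<open>The derived graph of the voltages \<open>w\<close> over the integers modulo
  \<open>N\<close>; \<open>N = 1\<close> gives the base dipole.\<close>

definition dipole :: "int \<Rightarrow> nat set \<Rightarrow> (nat \<Rightarrow> int) \<Rightarrow> (nat, nat) pre_digraph"
  where "dipole N J w = \<lparr>verts = to_nat ` dipole_verts N, arcs = to_nat ` dipole_arcs N J,
    tail = encoded (\<lambda>(x :: int, j :: nat, b :: bool). (x, b)),
    head = encoded (\<lambda>(x, j, b). (far N w x j b, \<not> b))\<rparr>"

definition dipole_rev :: "int \<Rightarrow> nat set \<Rightarrow> (nat \<Rightarrow> int) \<Rightarrow> nat \<Rightarrow> nat"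
  where "dipole_rev N J w e =
    (if e \<in> to_nat ` dipole_arcs N J then encoded (\<lambda>(x, j, b). (far N w x j b, j, \<not> b)) e else e)"

definition dipole_proj :: "(nat \<Rightarrow> nat) \<times> (nat \<Rightarrow> nat)"
  where "dipole_proj = (encoded (\<lambda>(x :: int, b :: bool). (0 :: int, b)),
    encoded (\<lambda>(x :: int, j :: nat, b :: bool). (0 :: int, j, b)))"

text \<open>Restriction makes it the extensional representative that membership in
  \<open>deck_group\<close> demands.\<close>

definition translation :: "int \<Rightarrow> nat set \<Rightarrow> int \<Rightarrow> (nat \<Rightarrow> nat) \<times> (nat \<Rightarrow> nat)"
  where "translation N J i =
    (restrict (encoded (\<lambda>(x :: int, b :: bool). ((x + i) mod N, b))) (to_nat ` dipole_verts N),
     restrict (encoded (\<lambda>(x :: int, j :: nat, b :: bool). ((x + i) mod N, j, b))) (to_nat ` dipole_arcs N J))"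

lemma dipole_simps:
  "verts (dipole N J w) = to_nat ` dipole_verts N"
  "arcs (dipole N J w) = to_nat ` dipole_arcs N J"
  "tail (dipole N J w) (to_nat (x, j, b)) = to_nat (x, b)"
  "head (dipole N J w) (to_nat (x, j, b)) = to_nat (far N w x j b, \<not> b)"
  by (simp_all add: dipole_def)

lemma dipole_rev_simp:
  "x \<in> {0..<N} \<Longrightarrow> j \<in> J \<Longrightarrow> dipole_rev N J w (to_nat (x, j, b)) = to_nat (far N w x j b, j, \<not> b)"
  by (simp add: dipole_rev_def)

lemma dipole_proj_simps:
  "fst dipole_proj (to_nat (x :: int, b :: bool)) = to_nat (0 :: int, b)"
  "snd dipole_proj (to_nat (x :: int, j :: nat, b :: bool)) = to_nat (0 :: int, j, b)"
  by (simp_all add: dipole_proj_def)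

lemma translation_simps:
  "x \<in> {0..<N} \<Longrightarrow> fst (translation N J i) (to_nat (x :: int, b :: bool)) = to_nat ((x + i) mod N, b)"
  "x \<in> {0..<N} \<Longrightarrow> j \<in> J \<Longrightarrow>
    snd (translation N J i) (to_nat (x :: int, j :: nat, b :: bool)) = to_nat ((x + i) mod N, j, b)"
  by (simp_all add: translation_def)

lemma translation_mod: "translation N J (i mod N) = translation N J i"
  by (simp add: translation_def mod_simps)

text \<open>The edges \<open>p\<close> of voltage 0 and \<open>q\<close> of voltage 1 connect the
  cover and force its deck transformations to be translations.\<close>

locale dipole_cover =
  fixes N :: int and J :: "nat set" and w :: "nat \<Rightarrow> int" and p q :: nat
  assumes N: "0 < N" and finite_J: "finite J"
    and p: "p \<in> J" "w p = 0" and q: "q \<in> J" "w q = 1"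
begin

abbreviation Y where "Y \<equiv> dipole N J w"
abbreviation \<iota>Y where "\<iota>Y \<equiv> dipole_rev N J w"
abbreviation B where "B \<equiv> dipole 1 J w"
abbreviation \<iota>B where "\<iota>B \<equiv> dipole_rev 1 J w"
abbreviation D where "D \<equiv> deck_group Y \<iota>Y dipole_proj"
abbreviation tr where "tr \<equiv> translation N J"

lemma far_in: "far N w x j b \<in> {0..<N}"
  using far_bounds[OF N] by simp

lemma mod_in: "x mod N \<in> {0..<N}"
  using N by simp

sublocale Y: dipole_graph N J w to_nat to_nat Y \<iota>Y
  by unfold_locales (use N finite_J in \<open>auto simp: dipole_simps dipole_rev_def intro: inj_on_subset[OF inj_to_nat]\<close>)

sublocale B: dipole_graph 1 J w to_nat to_nat B \<iota>B
  by unfold_locales (use finite_J in \<open>auto simp: dipole_simps dipole_rev_def intro: inj_on_subset[OF inj_to_nat]\<close>)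

lemma connected_Y: "Digraph_Component.connected Y"
  by (rule Y.connected_dipole[OF p q])

lemma connected_B: "Digraph_Component.connected B"
  by (rule B.connected_dipole[OF p q])

lemma vert_cases:
  assumes "v \<in> verts Y"
  obtains x b where "x \<in> {0..<N}" "v = to_nat (x :: int, b :: bool)"
  using assms by (auto simp: dipole_simps)

lemma vertsI: "x \<in> {0..<N} \<Longrightarrow> to_nat (x :: int, b :: bool) \<in> verts Y"
  by (auto simp: dipole_simps)

lemma arcsI: "x \<in> {0..<N} \<Longrightarrow> j \<in> J \<Longrightarrow> to_nat (x :: int, j :: nat, b :: bool) \<in> arcs Y"
  by (auto simp: dipole_simps)

lemma far_1: "far 1 w x j b = 0"
  by (simp add: far_def)

lemma morphism_proj: "graph_morphism Y \<iota>Y B \<iota>B dipole_proj"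
  unfolding graph_morphism_def
proof (intro conjI ballI image_subsetI)
  fix v assume "v \<in> verts Y"
  then obtain x b where "v = to_nat (x :: int, b :: bool)" by (rule vert_cases)
  then show "fst dipole_proj v \<in> verts B" by (auto simp: dipole_proj_simps dipole_simps)
next
  fix e assume "e \<in> arcs Y"
  then obtain x j b where e: "x \<in> {0..<N}" "j \<in> J" "e = to_nat (x :: int, j :: nat, b :: bool)" by (rule Y.arc_cases)
  show "snd dipole_proj e \<in> arcs B" using e by (auto simp: dipole_proj_simps dipole_simps)
  show "tail B (snd dipole_proj e) = fst dipole_proj (tail Y e)"
    using e by (simp add: dipole_proj_simps dipole_simps)
  show "head B (snd dipole_proj e) = fst dipole_proj (head Y e)"
    using e by (simp add: dipole_proj_simps dipole_simps far_1)
  show "\<iota>B (snd dipole_proj e) = snd dipole_proj (\<iota>Y e)"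
    using e by (simp add: dipole_proj_simps dipole_rev_simp far_1)
qed

lemma out_arcs_dipole:
  assumes "x \<in> {0..<N'}"
  shows "out_arcs (dipole N' J w) (to_nat (x, b :: bool)) = (\<lambda>j. to_nat (x, j, b)) ` J"
  using assms by (auto simp: out_arcs_def dipole_simps)

lemma cover_proj: "graph_cover Y \<iota>Y B \<iota>B dipole_proj"
  unfolding graph_cover_def
proof (intro conjI ballI Y.bidirected B.bidirected morphism_proj)
  show "fst dipole_proj ` verts Y = verts B"
    using N by (force simp: dipole_simps dipole_proj_simps image_image image_iff)
next
  fix v assume "v \<in> verts Y"
  then obtain x b where v: "x \<in> {0..<N}" "v = to_nat (x :: int, b :: bool)" by (rule vert_cases)
  show "bij_betw (snd dipole_proj) (out_arcs Y v) (out_arcs B (fst dipole_proj v))"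
    unfolding v(2) dipole_proj_simps out_arcs_dipole[OF v(1)]
    by (subst out_arcs_dipole) (auto simp: bij_betw_def inj_on_def image_image dipole_proj_simps)
qed

section \<open>Deck transformations and their group\<close>

lemma deck_carrier_iff:
  "\<sigma> \<in> carrier D \<longleftrightarrow> fst \<sigma> \<in> Bij (verts Y) \<and> snd \<sigma> \<in> Bij (arcs Y) \<and>
    graph_morphism Y \<iota>Y Y \<iota>Y \<sigma> \<and>
    (\<forall>v \<in> verts Y. fst dipole_proj (fst \<sigma> v) = fst dipole_proj v) \<and>
    (\<forall>e \<in> arcs Y. snd dipole_proj (snd \<sigma> e) = snd dipole_proj e)"
  by (auto simp: deck_group_def mem_Times_iff)

lemma tr_bij: "fst (tr i) \<in> Bij (verts Y)" "snd (tr i) \<in> Bij (arcs Y)"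
proof -
  have "bij_betw (fst (tr i)) (verts Y) (verts Y)"
  proof (rule bij_betw_byWitness[where f' = "fst (tr (- i))"])
    show "\<forall>v \<in> verts Y. fst (tr (- i)) (fst (tr i) v) = v"
      "\<forall>v \<in> verts Y. fst (tr i) (fst (tr (- i)) v) = v"
      using mod_in by (auto elim!: vert_cases simp: translation_simps mod_simps)
    show "fst (tr i) ` verts Y \<subseteq> verts Y" "fst (tr (- i)) ` verts Y \<subseteq> verts Y"
      using mod_in by (auto elim!: vert_cases simp: translation_simps intro!: vertsI)
  qed
  then show "fst (tr i) \<in> Bij (verts Y)"
    by (simp add: Bij_def translation_def dipole_simps)
  have "bij_betw (snd (tr i)) (arcs Y) (arcs Y)"
  proof (rule bij_betw_byWitness[where f' = "snd (tr (- i))"])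
    show "\<forall>v \<in> arcs Y. snd (tr (- i)) (snd (tr i) v) = v"
      "\<forall>v \<in> arcs Y. snd (tr i) (snd (tr (- i)) v) = v"
      using mod_in by (auto elim!: Y.arc_cases simp: translation_simps mod_simps)
    show "snd (tr i) ` arcs Y \<subseteq> arcs Y" "snd (tr (- i)) ` arcs Y \<subseteq> arcs Y"
      using mod_in by (auto elim!: Y.arc_cases simp: translation_simps intro!: arcsI)
  qed
  then show "snd (tr i) \<in> Bij (arcs Y)"
    by (simp add: Bij_def translation_def dipole_simps)
qed

lemma tr_in_deck: "tr i \<in> carrier D"
  unfolding deck_carrier_iff
proof (intro conjI ballI tr_bij)
  show "graph_morphism Y \<iota>Y Y \<iota>Y (tr i)"
    unfolding graph_morphism_def
  proof (intro conjI ballI)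
    show "fst (tr i) ` verts Y \<subseteq> verts Y" "snd (tr i) ` arcs Y \<subseteq> arcs Y"
      using tr_bij[of i] by (auto simp: Bij_def bij_betw_def)
  next
    fix e assume "e \<in> arcs Y"
    then obtain x j b where e: "x \<in> {0..<N}" "j \<in> J" "e = to_nat (x :: int, j :: nat, b :: bool)" by (rule Y.arc_cases)
    show "tail Y (snd (tr i) e) = fst (tr i) (tail Y e)"
      using e by (simp add: translation_simps dipole_simps)
    show "head Y (snd (tr i) e) = fst (tr i) (head Y e)"
      using e far_in[of x j b] by (simp add: translation_simps dipole_simps far_add)
    show "\<iota>Y (snd (tr i) e) = snd (tr i) (\<iota>Y e)"
      using e far_in[of x j b] mod_in[of "x + i"]
      by (simp add: translation_simps dipole_rev_simp far_add)
  qed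
next
  fix v assume "v \<in> verts Y"
  then obtain x b where "x \<in> {0..<N}" "v = to_nat (x :: int, b :: bool)" by (rule vert_cases)
  then show "fst dipole_proj (fst (tr i) v) = fst dipole_proj v"
    by (simp add: translation_simps dipole_proj_simps)
next
  fix e assume "e \<in> arcs Y"
  then obtain x j b where "x \<in> {0..<N}" "j \<in> J" "e = to_nat (x :: int, j :: nat, b :: bool)" by (rule Y.arc_cases)
  then show "snd dipole_proj (snd (tr i) e) = snd dipole_proj e"
    by (simp add: translation_simps dipole_proj_simps)
qed

text \<open>A deck transformation is determined by the image of one vertex; the edges of voltage 1 propagate it.\<close>

lemma deck_is_tr:
  assumes \<sigma>: "\<sigma> \<in> carrier D"
  shows "\<exists>i \<in> {0..<N}. \<sigma> = tr i"
proof -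
  have Bij: "fst \<sigma> \<in> Bij (verts Y)" "snd \<sigma> \<in> Bij (arcs Y)"
    and mor: "graph_morphism Y \<iota>Y Y \<iota>Y \<sigma>"
    and pv: "\<And>v. v \<in> verts Y \<Longrightarrow> fst dipole_proj (fst \<sigma> v) = fst dipole_proj v"
    and pe: "\<And>e. e \<in> arcs Y \<Longrightarrow> snd dipole_proj (snd \<sigma> e) = snd dipole_proj e"
    using \<sigma> unfolding deck_carrier_iff by blast+
  have ex: "\<exists>y. y \<in> {0..<N} \<and> fst \<sigma> (to_nat (x, b)) = to_nat (y, b)" if "x \<in> {0..<N}" for x :: int and b :: bool
  proof -
    have "fst \<sigma> (to_nat (x, b)) \<in> verts Y"
      using Bij(1) vertsI[OF that] by (auto simp: Bij_def bij_betw_def)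
    then obtain y c where y: "y \<in> {0..<N}" "fst \<sigma> (to_nat (x, b)) = to_nat (y :: int, c :: bool)"
      by (rule vert_cases)
    then show ?thesis using pv[OF vertsI[OF that], of b] by (auto simp: dipole_proj_simps)
  qed
  \<comment> \<open>\<open>\<sigma>\<close> commutes with the projection, so it preserves flags and
    edge indices and moves only the first coordinate; \<open>s\<close> records this motion for
    vertices and edges alike.\<close>
  define s where "s x b = (SOME y. y \<in> {0..<N} \<and> fst \<sigma> (to_nat (x, b)) = to_nat (y, b))"
    for x :: int and b :: bool
  have s: "s x b \<in> {0..<N} \<and> fst \<sigma> (to_nat (x, b)) = to_nat (s x b, b)" if "x \<in> {0..<N}" for x b
    unfolding s_def by (rule someI_ex[OF ex[OF that]])
  have arc: "snd \<sigma> (to_nat (x, j, b)) = to_nat (s x b, j, b)" if x: "x \<in> {0..<N}" "j \<in> J" for x :: int and j :: nat and b :: bool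
  proof -
    have "snd \<sigma> (to_nat (x, j, b)) \<in> arcs Y"
      using Bij(2) arcsI[OF that] by (auto simp: Bij_def bij_betw_def)
    then obtain y k c where y: "y \<in> {0..<N}" "k \<in> J" "snd \<sigma> (to_nat (x, j, b)) = to_nat (y :: int, k :: nat, c :: bool)"
      by (rule Y.arc_cases)
    moreover have "k = j" "c = b"
      using pe[OF arcsI[OF that], of b] y by (auto simp: dipole_proj_simps)
    moreover have "tail Y (snd \<sigma> (to_nat (x, j, b))) = fst \<sigma> (tail Y (to_nat (x, j, b)))"
      using mor arcsI[OF that] by (simp add: graph_morphism_def)
    ultimately show ?thesis using s[OF x(1)] by (simp add: dipole_simps)
  qed
  have far: "s (far N w x j b) (\<not> b) = far N w (s x b) j b" if x: "x \<in> {0..<N}" "j \<in> J" for x :: int and j :: nat and b :: bool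
  proof -
    have "head Y (snd \<sigma> (to_nat (x, j, b))) = fst \<sigma> (head Y (to_nat (x, j, b)))"
      using mor arcsI[OF that] by (simp add: graph_morphism_def)
    then show ?thesis using arc[OF that] s[OF far_in] by (simp add: dipole_simps)
  qed
  \<comment> \<open>Following edge \<open>p\<close> shows that both levels move alike; following
    edge \<open>q\<close> then shows that \<open>s\<close> commutes with adding 1.\<close>
  have TF: "s x True = s x False" if "x \<in> {0..<N}" for x
    using far[OF that p(1), of False] s[OF that] that by (simp add: far_def p(2))
  have step: "s ((x + 1) mod N) False = (s x False + 1) mod N" if "x \<in> {0..<N}" for x
    using far[OF that q(1), of False] TF[OF mod_in] by (simp add: far_def q(2))
  define i where "i = s 0 False"
  have i: "i \<in> {0..<N}" using s[of 0] N by (simp add: i_def)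
  have nat: "int n < N \<Longrightarrow> s (int n) False = (int n + i) mod N" for n
  proof (induction n)
    case 0
    then show ?case using i by (simp add: i_def)
  next
    case (Suc n)
    then show ?case using step[of "int n"] by (simp add: mod_simps algebra_simps)
  qed
  have sx: "s x b = (x + i) mod N" if "x \<in> {0..<N}" for x b
    using nat[of "nat x"] TF[OF that] that by (cases b) auto
  have "\<sigma> = tr i"
  proof (rule prod_eqI)
    show "fst \<sigma> = fst (tr i)"
    proof (rule extensionalityI[of _ "verts Y"])
      fix v assume "v \<in> verts Y"
      then obtain x b where "x \<in> {0..<N}" "v = to_nat (x :: int, b :: bool)" by (rule vert_cases)
      then show "fst \<sigma> v = fst (tr i) v" using s sx by (simp add: translation_simps)
    qed (use Bij(1) tr_bij(1) in \<open>auto simp: Bij_def\<close>)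
    show "snd \<sigma> = snd (tr i)"
    proof (rule extensionalityI[of _ "arcs Y"])
      fix e assume "e \<in> arcs Y"
      then obtain x j b where "x \<in> {0..<N}" "j \<in> J" "e = to_nat (x :: int, j :: nat, b :: bool)" by (rule Y.arc_cases)
      then show "snd \<sigma> e = snd (tr i) e" using arc sx by (simp add: translation_simps)
    qed (use Bij(2) tr_bij(2) in \<open>auto simp: Bij_def\<close>)
  qed
  then show ?thesis using i by blast
qed

lemma galois: "galois_cover Y \<iota>Y B \<iota>B dipole_proj"
  unfolding galois_cover_def
proof (intro conjI ballI impI cover_proj connected_Y)
  fix v y z assume "y \<in> verts Y" "z \<in> verts Y" and eq: "fst dipole_proj y = v \<and> fst dipole_proj z = v"
  then obtain x b x' b' where yz: "x \<in> {0..<N}" "y = to_nat (x :: int, b :: bool)"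
    "x' \<in> {0..<N}" "z = to_nat (x' :: int, b' :: bool)" by (elim vert_cases)
  then have "b = b'" using eq by (auto simp: dipole_proj_simps)
  then have "fst (tr (x' - x)) y = z" using yz by (simp add: translation_simps)
  then show "\<exists>\<sigma> \<in> carrier D. fst \<sigma> y = z" using tr_in_deck by blast
qed

lemma tr_mult: "tr i \<otimes>\<^bsub>D\<^esub> tr k = tr (i + k)"
proof -
  have "tr i \<otimes>\<^bsub>D\<^esub> tr k = (compose (verts Y) (fst (tr i)) (fst (tr k)), compose (arcs Y) (snd (tr i)) (snd (tr k)))"
    using tr_bij[of i] tr_bij[of k]
    by (simp add: deck_group_def DirProd_def BijGroup_def case_prod_beta)
  also have "\<dots> = tr (i + k)"
  proof (rule prod_eqI)
    show "fst (compose (verts Y) (fst (tr i)) (fst (tr k)), compose (arcs Y) (snd (tr i)) (snd (tr k)))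
        = fst (tr (i + k))"
    proof (rule extensionalityI[of _ "verts Y"])
      fix v assume v: "v \<in> verts Y"
      then obtain x b where "x \<in> {0..<N}" "v = to_nat (x :: int, b :: bool)" by (rule vert_cases)
      then show "fst (compose (verts Y) (fst (tr i)) (fst (tr k)), compose (arcs Y) (snd (tr i)) (snd (tr k))) v
          = fst (tr (i + k)) v"
        using v mod_in[of "x + k"] by (simp add: compose_eq translation_simps mod_simps algebra_simps)
    qed (use tr_bij(1) in \<open>auto simp: Bij_def compose_extensional\<close>)
    show "snd (compose (verts Y) (fst (tr i)) (fst (tr k)), compose (arcs Y) (snd (tr i)) (snd (tr k)))
        = snd (tr (i + k))"
    proof (rule extensionalityI[of _ "arcs Y"])
      fix e assume e: "e \<in> arcs Y"
      then obtain x j b where "x \<in> {0..<N}" "j \<in> J" "e = to_nat (x :: int, j :: nat, b :: bool)" by (rule Y.arc_cases)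
      then show "snd (compose (verts Y) (fst (tr i)) (fst (tr k)), compose (arcs Y) (snd (tr i)) (snd (tr k))) e
          = snd (tr (i + k)) e"
        using e mod_in[of "x + k"] by (simp add: compose_eq translation_simps mod_simps algebra_simps)
    qed (use tr_bij(2) in \<open>auto simp: Bij_def compose_extensional\<close>)
  qed
  finally show ?thesis .
qed

lemma tr_iso: "tr \<in> iso (integer_mod_group (nat N)) D"
proof -
  have carrier: "carrier (integer_mod_group (nat N)) = {0..<N}"
    using N by (simp add: carrier_integer_mod_group)
  have "tr \<in> hom (integer_mod_group (nat N)) D"
    by (rule homI) (use N in \<open>simp_all add: tr_in_deck tr_mult translation_mod\<close>)
  moreover have "bij_betw tr {0..<N} (carrier D)"
    unfolding bij_betw_def
  proof
    show "inj_on tr {0..<N}"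
    proof (rule inj_onI)
      fix i k assume i: "i \<in> {0..<N}" "k \<in> {0..<N}" "tr i = tr k"
      then have "fst (tr i) (to_nat (0 :: int, False)) = fst (tr k) (to_nat (0 :: int, False))" by simp
      then show "i = k" using N i(1,2) by (simp add: translation_simps)
    qed
    show "tr ` {0..<N} = carrier D" using deck_is_tr tr_in_deck by blast
  qed
  ultimately show ?thesis by (simp add: iso_def carrier)
qed

section \<open>Quotients of the cyclic cover\<close>

lemma translates_by_multiples:
  fixes x e :: int
  assumes e: "e dvd N" and x: "x \<in> {0..<N}"
  shows "{(x + i) mod N | i. i \<in> {0..<N} \<and> e dvd i} = {y \<in> {0..<N}. y mod e = x mod e}"
proof (intro equalityI subsetI)
  fix y assume "y \<in> {(x + i) mod N | i. i \<in> {0..<N} \<and> e dvd i}"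
  then obtain i where i: "y = (x + i) mod N" "e dvd i" by blast
  then have "(x + i) mod e = x mod e" by (auto elim!: dvdE)
  then show "y \<in> {y \<in> {0..<N}. y mod e = x mod e}"
    using i e mod_in by (simp add: mod_mod_cancel)
next
  fix y assume "y \<in> {y \<in> {0..<N}. y mod e = x mod e}"
  then have y: "y \<in> {0..<N}" "e dvd y - x" by (auto simp: mod_eq_dvd_iff)
  \<comment> \<open>The shift is the difference reduced into \<open>{0..<N}\<close>; as
    \<open>e\<close> divides \<open>N\<close>, reduction keeps it a multiple of
    \<open>e\<close>.\<close>
  then have "e dvd (y - x) mod N" using e by (simp add: dvd_mod_iff)
  moreover have "y = (x + (y - x) mod N) mod N" using y(1) by (simp add: mod_simps)
  ultimately show "y \<in> {(x + i) mod N | i. i \<in> {0..<N} \<and> e dvd i}"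
    using mod_in[of "y - x"] by blast
qed

text \<open>The orbits are the residue classes modulo \<open>e\<close>, and \<open>far\<close> is
  compatible with reduction from \<open>N\<close> to \<open>e\<close>. Hence the quotient is the
  derived dipole over the integers modulo \<open>e\<close>, with orbits as coordinates.\<close>

lemma dipole_quotient:
  assumes e: "0 < e" "e dvd N" and H: "H = tr ` {i \<in> {0..<N}. e dvd i}"
  defines "K \<equiv> D\<lparr>carrier := H\<rparr>"
  shows "dipole_graph e J w (\<lambda>(x, b). to_nat ` ({y \<in> {0..<N}. y mod e = x} \<times> {b}))
    (\<lambda>(x, j, b). to_nat ` ({y \<in> {0..<N}. y mod e = x} \<times> {j} \<times> {b}))
    (quotient_graph K Y) (quotient_rev K Y \<iota>Y)"
proof -
  let ?C = "\<lambda>x. {y \<in> {0..<N}. y mod e = x}"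
  let ?\<beta> = "\<lambda>(x :: int, b :: bool). to_nat ` (?C x \<times> {b})"
  let ?\<epsilon> = "\<lambda>(x :: int, j :: nat, b :: bool). to_nat ` (?C x \<times> {j} \<times> {b})"
  have e_le: "e \<le> N" using e N by (simp add: zdvd_imp_le)
  have C: "x \<in> ?C x" if "x \<in> {0..<e}" for x using that e_le by auto
  have vorbit: "Group_Action.orbit K fst (to_nat (x, b)) = ?\<beta> (x mod e, b)" if "x \<in> {0..<N}" for x :: int and b :: bool
  proof -
    have "Group_Action.orbit K fst (to_nat (x, b)) = (\<lambda>\<sigma>. fst \<sigma> (to_nat (x, b))) ` H"
      unfolding Group_Action.orbit_def K_def setcompr_eq_image by simp
    also have "\<dots> = (\<lambda>i. to_nat ((x + i) mod N, b)) ` {i \<in> {0..<N}. e dvd i}"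
      unfolding H image_image using that by (intro image_cong refl) (simp add: translation_simps)
    also have "\<dots> = (\<lambda>y. to_nat (y, b)) ` {(x + i) mod N | i. i \<in> {0..<N} \<and> e dvd i}"
      by (simp only: setcompr_eq_image image_image)
    finally have "Group_Action.orbit K fst (to_nat (x, b)) =
      (\<lambda>y. to_nat (y, b)) ` {(x + i) mod N | i. i \<in> {0..<N} \<and> e dvd i}" .
    then show ?thesis unfolding translates_by_multiples[OF e(2) that] by auto
  qed
  have aorbit: "Group_Action.orbit K snd (to_nat (x, j, b)) = ?\<epsilon> (x mod e, j, b)" if "x \<in> {0..<N}" "j \<in> J" for x :: int and j :: nat and b :: bool
  proof -
    have "Group_Action.orbit K snd (to_nat (x, j, b)) = (\<lambda>\<sigma>. snd \<sigma> (to_nat (x, j, b))) ` H"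
      unfolding Group_Action.orbit_def K_def setcompr_eq_image by simp
    also have "\<dots> = (\<lambda>i. to_nat ((x + i) mod N, j, b)) ` {i \<in> {0..<N}. e dvd i}"
      unfolding H image_image using that by (intro image_cong refl) (simp add: translation_simps)
    also have "\<dots> = (\<lambda>y. to_nat (y, j, b)) ` {(x + i) mod N | i. i \<in> {0..<N} \<and> e dvd i}"
      by (simp only: setcompr_eq_image image_image)
    finally have "Group_Action.orbit K snd (to_nat (x, j, b)) =
      (\<lambda>y. to_nat (y, j, b)) ` {(x + i) mod N | i. i \<in> {0..<N} \<and> e dvd i}" .
    then show ?thesis unfolding translates_by_multiples[OF e(2) that(1)] by auto
  qed
  have verts: "Group_Action.orbits K (verts Y) fst = ?\<beta> ` dipole_verts e"
  proof (intro equalityI subsetI)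
    fix A assume "A \<in> Group_Action.orbits K (verts Y) fst"
    then obtain v where "v \<in> verts Y" "A = Group_Action.orbit K fst v" by (auto simp: Group_Action.orbits_def)
    then obtain x b where "x \<in> {0..<N}" "A = ?\<beta> (x mod e, b)"
      using vorbit by (auto elim!: vert_cases)
    then show "A \<in> ?\<beta> ` dipole_verts e" using e(1) by (intro image_eqI[of _ _ "(x mod e, b)"]) auto
  next
    fix A assume "A \<in> ?\<beta> ` dipole_verts e"
    then obtain x b where x: "x \<in> {0..<e}" "A = ?\<beta> (x, b)" by auto
    then have "A = Group_Action.orbit K fst (to_nat (x, b))" using vorbit[of x b] e_le by simp
    moreover have "to_nat (x, b) \<in> verts Y" using x e_le by (intro vertsI) auto
    ultimately show "A \<in> Group_Action.orbits K (verts Y) fst" by (auto simp: Group_Action.orbits_def)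
  qed
  have arcs: "Group_Action.orbits K (arcs Y) snd = ?\<epsilon> ` dipole_arcs e J"
  proof (intro equalityI subsetI)
    fix A assume "A \<in> Group_Action.orbits K (arcs Y) snd"
    then obtain v where "v \<in> arcs Y" "A = Group_Action.orbit K snd v" by (auto simp: Group_Action.orbits_def)
    then obtain x j b where "x \<in> {0..<N}" "j \<in> J" "A = ?\<epsilon> (x mod e, j, b)"
      using aorbit by (auto elim!: Y.arc_cases)
    then show "A \<in> ?\<epsilon> ` dipole_arcs e J" using e(1) by (intro image_eqI[of _ _ "(x mod e, j, b)"]) auto
  next
    fix A assume "A \<in> ?\<epsilon> ` dipole_arcs e J"
    then obtain x j b where x: "x \<in> {0..<e}" "j \<in> J" "A = ?\<epsilon> (x, j, b)" by auto
    then have "A = Group_Action.orbit K snd (to_nat (x, j, b))" using aorbit[of x j b] e_le by simp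
    moreover have "to_nat (x, j, b) \<in> arcs Y" using x e_le by (intro arcsI) auto
    ultimately show "A \<in> Group_Action.orbits K (arcs Y) snd" by (auto simp: Group_Action.orbits_def)
  qed
  \<comment> \<open>Endpoints of an orbit are images of sets, so \<open>far\<close> has to map a
    residue class onto a whole class; walking back along the reversed arc gives the
    preimages.\<close>
  have far_C: "(\<lambda>y. far N w y j b) ` ?C x = ?C (far e w x j b)" if x: "x \<in> {0..<e}" for x j b
  proof (intro equalityI subsetI)
    fix y assume "y \<in> (\<lambda>y. far N w y j b) ` ?C x"
    then show "y \<in> ?C (far e w x j b)" using far_in far_mod[OF e(2)] by auto
  next
    fix y assume y: "y \<in> ?C (far e w x j b)"
    let ?z = "far N w y j (\<not> b)"
    have "?z mod e = x"
      using y far_mod[OF e(2), of w y j "\<not> b"] far_far[of e w x j b] x by simp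
    moreover have "far N w ?z j b = y"
      using y far_far[of N w y j "\<not> b"] by simp
    ultimately show "y \<in> (\<lambda>y. far N w y j b) ` ?C x"
      using far_in by (intro image_eqI[of _ _ ?z]) auto
  qed
  show ?thesis
  proof
    show "inj_on ?\<beta> (dipole_verts e)"
    proof (rule inj_onI)
      fix z z' assume z: "z \<in> dipole_verts e" and eq: "?\<beta> z = ?\<beta> z'"
      obtain x b x' b' where xb: "z = (x, b)" "z' = (x', b')" by (cases z, cases z')
      have "?C x \<times> {b} = ?C x' \<times> {b'}"
        using eq xb by (simp add: inj_image_eq_iff[OF inj_to_nat])
      \<comment> \<open>The representative \<open>x < e\<close> lies in its own class and equals its
        residue, so it identifies the class.\<close>
      then have "(x, b) \<in> ?C x' \<times> {b'}" using C[of x] z xb(1) by blast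
      then show "z = z'" using z xb by auto
    qed
    show "inj_on ?\<epsilon> (dipole_arcs e J)"
    proof (rule inj_onI)
      fix z z' assume z: "z \<in> dipole_arcs e J" and eq: "?\<epsilon> z = ?\<epsilon> z'"
      obtain x j b x' j' b' where xb: "z = (x, j, b)" "z' = (x', j', b')" by (cases z, cases z')
      have "?C x \<times> {j} \<times> {b} = ?C x' \<times> {j'} \<times> {b'}"
        using eq xb by (simp add: inj_image_eq_iff[OF inj_to_nat])
      then have "(x, j, b) \<in> ?C x' \<times> {j'} \<times> {b'}" using C[of x] z xb(1) by blast
      then show "z = z'" using z xb by auto
    qed
    fix x :: int and j :: nat and b :: bool
    assume x: "x \<in> {0..<e}" "j \<in> J"
    have "tail Y ` ?\<epsilon> (x, j, b) = ?\<beta> (x, b)"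
      by (auto simp: image_iff dipole_simps)
    then show "tail (quotient_graph K Y) (?\<epsilon> (x, j, b)) = ?\<beta> (x, b)"
      by (simp add: quotient_graph_def)
    have "head Y ` ?\<epsilon> (x, j, b) = (\<lambda>y. to_nat (y, \<not> b)) ` ((\<lambda>y. far N w y j b) ` ?C x)"
      by (auto simp: image_iff dipole_simps)
    also have "\<dots> = ?\<beta> (far e w x j b, \<not> b)"
      unfolding far_C[OF x(1)] by auto
    finally show "head (quotient_graph K Y) (?\<epsilon> (x, j, b)) = ?\<beta> (far e w x j b, \<not> b)"
      by (simp add: quotient_graph_def)
    have mem: "?\<epsilon> (x, j, b) \<in> ?\<epsilon> ` dipole_arcs e J"
      by (rule imageI) (use x in simp)
    have "\<iota>Y ` ?\<epsilon> (x, j, b) = (\<lambda>y. to_nat (y, j, \<not> b)) ` ((\<lambda>y. far N w y j b) ` ?C x)"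
      using x by (auto simp: image_iff dipole_rev_simp)
    also have "\<dots> = ?\<epsilon> (far e w x j b, j, \<not> b)"
      unfolding far_C[OF x(1)] by auto
    finally show "quotient_rev K Y \<iota>Y (?\<epsilon> (x, j, b)) = ?\<epsilon> (far e w x j b, j, \<not> b)"
      by (simp only: quotient_rev_def arcs mem if_True)
  qed (use e finite_J in \<open>simp_all add: quotient_graph_def quotient_rev_def verts arcs\<close>)
qed

lemma intermediate_complexity_dipole:
  assumes "0 < e" "e dvd N"
  shows "intermediate_complexity Y \<iota>Y dipole_proj (tr ` {i \<in> {0..<N}. e dvd i}) =
    card (tree_sets (dipole_verts e) dipole_tail (dipole_head e w) ({0..<e} \<times> J))"
proof -
  interpret Q: dipole_graph e J w "\<lambda>(x, b). to_nat ` ({y \<in> {0..<N}. y mod e = x} \<times> {b})"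
    "\<lambda>(x, j, b). to_nat ` ({y \<in> {0..<N}. y mod e = x} \<times> {j} \<times> {b})"
    "quotient_graph (D\<lparr>carrier := tr ` {i \<in> {0..<N}. e dvd i}\<rparr>) Y"
    "quotient_rev (D\<lparr>carrier := tr ` {i \<in> {0..<N}. e dvd i}\<rparr>) Y \<iota>Y"
    by (rule dipole_quotient[OF assms refl])
  show ?thesis
    unfolding intermediate_complexity_def Let_def by (rule Q.complexity_dipole)
qed

end

section \<open>Relations among exponents\<close>

text \<open>\<open>gcd (e i) c\<close> is the sum of \<open>totient d\<close> over the common
  divisors \<open>d\<close>, so the gcd matrix factors through divisibility. The relation says that
  the totient-weighted sums of \<open>M\<close> over the divisors of each \<open>c\<close> vanish,
  where \<open>M d\<close> adds up the \<open>m i\<close> with \<open>d\<close> dividing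
  \<open>e i\<close>; both triangular systems are then inverted.\<close>

lemma gcd_relation_trivial:
  fixes e :: "'i \<Rightarrow> nat" and m :: "'i \<Rightarrow> int"
  assumes I: "finite I" "inj_on e I" and n: "0 < n" and e: "\<And>i. i \<in> I \<Longrightarrow> e i dvd n"
    and rel: "\<And>c. c dvd n \<Longrightarrow> (\<Sum>i\<in>I. m i * int (gcd (e i) c)) = 0"
  shows "\<forall>i \<in> I. m i = 0"
proof -
  define M where "M d = (\<Sum>i\<in>I. if d dvd e i then m i else 0)" for d
  have sum_M: "(\<Sum>d | d dvd c. int (totient d) * M d) = 0" if c: "c dvd n" for c
  proof -
    have fin: "finite {d. d dvd c}" using c n by (auto intro: finite_divisors_nat dvd_pos_nat)
    have "int (gcd (e i) c) = (\<Sum>d | d dvd c. if d dvd e i then int (totient d) else 0)" for i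
    proof -
      have "(\<Sum>d | d dvd c. if d dvd e i then int (totient d) else 0)
          = (\<Sum>d \<in> {d. d dvd c} \<inter> {d. d dvd e i}. int (totient d))"
        by (simp add: sum.inter_restrict[OF fin])
      also have "{d. d dvd c} \<inter> {d. d dvd e i} = {d. d dvd gcd (e i) c}" by auto
      also have "(\<Sum>d | d dvd gcd (e i) c. int (totient d)) = int (gcd (e i) c)"
        by (metis of_nat_sum totient_divisor_sum)
      finally show ?thesis by simp
    qed
    then have "0 = (\<Sum>i\<in>I. m i * (\<Sum>d | d dvd c. if d dvd e i then int (totient d) else 0))"
      using rel[OF c] by simp
    also have "\<dots> = (\<Sum>i\<in>I. \<Sum>d | d dvd c. int (totient d) * (if d dvd e i then m i else 0))"
      unfolding sum_distrib_left by (intro sum.cong refl) simp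
    also have "\<dots> = (\<Sum>d | d dvd c. int (totient d) * M d)"
      by (subst sum.swap) (simp add: M_def sum_distrib_left)
    finally show ?thesis by simp
  qed
  \<comment> \<open>The relation at \<open>c = d\<close> has a single term not covered by the
    induction hypothesis, with nonzero coefficient \<open>totient d\<close>.\<close>
  have M0: "d dvd n \<Longrightarrow> M d = 0" for d
  proof (induction d rule: less_induct)
    case (less d)
    have pos: "0 < d" using less.prems n by (auto intro: dvd_pos_nat)
    have fin: "finite {c. c dvd d}" using pos by simp
    have "int (totient c) * M c = 0" if "c \<in> {c. c dvd d} - {d}" for c
    proof -
      have "c < d" using that pos by (auto dest: dvd_imp_le)
      then show ?thesis using less that by (auto intro: dvd_trans)
    qed
    then have "(\<Sum>c \<in> {c. c dvd d} - {d}. int (totient c) * M c) = 0" by (rule sum.neutral[OF ballI])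
    then have "int (totient d) * M d = 0"
      using sum_M[OF less.prems] sum.remove[OF fin, of d "\<lambda>c. int (totient c) * M c"] by simp
    then show ?case using pos by simp
  qed
  show ?thesis
  proof (rule ccontr)
    assume "\<not> ?thesis"
    then have ne: "e ` {i \<in> I. m i \<noteq> 0} \<noteq> {}" and fin: "finite (e ` {i \<in> I. m i \<noteq> 0})" using I by auto
    \<comment> \<open>With \<open>e i\<close> maximal among the values carrying a nonzero exponent,
      no other such \<open>e l\<close> is a multiple of it, so \<open>M (e i)\<close> reduces to
      \<open>m i\<close>.\<close>
    obtain i where i: "i \<in> I" "m i \<noteq> 0" "e i = Max (e ` {i \<in> I. m i \<noteq> 0})"
      using Max_in[OF fin ne] by auto
    have "(if e i dvd e l then m l else 0) = 0" if "l \<in> I - {i}" for l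
    proof (rule ccontr)
      assume "\<not> ?thesis"
      then have l: "e i dvd e l" "m l \<noteq> 0" by (auto split: if_splits)
      have "0 < e l" using e that n by (auto intro: dvd_pos_nat)
      then have "e i \<le> e l" using l(1) dvd_imp_le by blast
      moreover have "e l \<le> e i" unfolding i(3) using l(2) that fin by (intro Max_ge) auto
      ultimately show False using I(2) i(1) that by (auto simp: inj_on_def)
    qed
    then have "M (e i) = m i"
      unfolding M_def using sum.remove[OF I(1) i(1), of "\<lambda>l. if e i dvd e l then m l else 0"]
      by (simp add: sum.neutral)
    then show False using M0[OF e[OF i(1)]] i(2) by simp
  qed
qed

text \<open>In logarithms, \<open>L a\<close> stays within a constant \<open>K\<close> of
  \<open>S * ln a\<close>, while the relation makes \<open>L a\<close> independent of
  \<open>a\<close>; letting \<open>a\<close> grow forces the integer \<open>S\<close> to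
  vanish.\<close>

lemma growth_relation:
  fixes \<tau> :: "'i \<Rightarrow> nat \<Rightarrow> nat" and m :: "'i \<Rightarrow> int" and r C :: "'i \<Rightarrow> nat" and q :: rat
  assumes I: "finite I" and C: "\<And>i. i \<in> I \<Longrightarrow> 0 < C i"
    and lower: "\<And>i a. i \<in> I \<Longrightarrow> 0 < a \<Longrightarrow> a ^ r i \<le> \<tau> i a"
    and upper: "\<And>i a. i \<in> I \<Longrightarrow> 0 < a \<Longrightarrow> \<tau> i a \<le> C i * a ^ r i"
    and rel: "\<And>a. 0 < a \<Longrightarrow> q * (\<Prod>i\<in>I. of_nat (\<tau> i a) powi m i) = 1"
  shows "(\<Sum>i\<in>I. m i * int (r i)) = 0"
proof (rule ccontr)
  define S where "S = (\<Sum>i\<in>I. m i * int (r i))"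
  assume "(\<Sum>i\<in>I. m i * int (r i)) \<noteq> 0"
  then have S1: "1 \<le> \<bar>real_of_int S\<bar>" unfolding S_def[symmetric] by linarith
  have pos: "0 < \<tau> i a" if "i \<in> I" "0 < a" for i a
    using lower[OF that] that(2) by (metis gr0I le_zero_eq power_not_zero)
  define L where "L a = (\<Sum>i\<in>I. real_of_int (m i) * ln (real (\<tau> i a)))" for a
  have ln_prod_eq: "ln (\<Prod>i\<in>I. real (\<tau> i a) powi m i) = L a" if "0 < a" for a
  proof -
    have "ln (\<Prod>i\<in>I. real (\<tau> i a) powi m i) = (\<Sum>i\<in>I. ln (real (\<tau> i a) powi m i))"
      by (rule ln_prod[OF I]) (use pos that in auto)
    also have "\<dots> = L a"
      unfolding L_def using pos that by (intro sum.cong refl) (simp add: powr_real_of_int'[symmetric] ln_powr)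
    finally show ?thesis .
  qed
  have of_rat_prod_eq: "of_rat (\<Prod>i\<in>I. of_nat (\<tau> i a) powi m i) = (\<Prod>i\<in>I. real (\<tau> i a) powi m i)" for a
    unfolding of_rat_prod
    by (intro prod.cong refl) (simp add: power_int_def of_rat_power of_rat_inverse)
  have const: "L a = L 1" if "0 < a" for a
  proof -
    have "q \<noteq> 0" using rel[of 1] by auto
    then have "(\<Prod>i\<in>I. of_nat (\<tau> i a) powi m i :: rat) = (\<Prod>i\<in>I. of_nat (\<tau> i 1) powi m i)"
      using rel[OF that] rel[of 1] by (metis mult_left_cancel zero_less_one)
    then have "(\<Prod>i\<in>I. real (\<tau> i a) powi m i) = (\<Prod>i\<in>I. real (\<tau> i 1) powi m i)"
      using of_rat_prod_eq by metis
    then show ?thesis using ln_prod_eq that by (metis zero_less_one)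
  qed
  define K where "K = (\<Sum>i\<in>I. \<bar>real_of_int (m i)\<bar> * ln (real (C i)))"
  have bound: "\<bar>L a - real_of_int S * ln (real a)\<bar> \<le> K" if a: "0 < a" for a
  proof -
    have "real_of_int S * ln (real a) = (\<Sum>i\<in>I. real_of_int (m i) * (real (r i) * ln (real a)))"
      by (simp add: S_def sum_distrib_right mult.assoc)
    then have "L a - real_of_int S * ln (real a)
        = (\<Sum>i\<in>I. real_of_int (m i) * (ln (real (\<tau> i a)) - real (r i) * ln (real a)))"
      by (simp add: L_def sum_subtractf right_diff_distrib)
    also have "\<bar>\<dots>\<bar> \<le> (\<Sum>i\<in>I. \<bar>real_of_int (m i) * (ln (real (\<tau> i a)) - real (r i) * ln (real a))\<bar>)"
      by (rule sum_abs)
    also have "\<dots> \<le> K"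
      unfolding K_def abs_mult
    proof (intro sum_mono mult_left_mono)
      fix i assume i: "i \<in> I"
      have low: "real a ^ r i \<le> real (\<tau> i a)"
        using lower[OF i a] by (metis of_nat_le_iff of_nat_power)
      have "real (\<tau> i a) \<le> real (C i) * real a ^ r i"
        using upper[OF i a] by (metis of_nat_le_iff of_nat_power of_nat_mult)
      then have "ln (real (\<tau> i a)) \<le> ln (real (C i) * real a ^ r i)"
        using pos[OF i a] C[OF i] a by (intro iffD2[OF ln_le_cancel_iff]) auto
      also have "\<dots> = ln (real (C i)) + real (r i) * ln (real a)"
        using C[OF i] a by (simp add: ln_mult ln_realpow)
      finally have up: "ln (real (\<tau> i a)) - real (r i) * ln (real a) \<le> ln (real (C i))" by simp
      have "ln (real a ^ r i) \<le> ln (real (\<tau> i a))"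
        using low a pos[OF i a] by (intro iffD2[OF ln_le_cancel_iff]) auto
      then have "0 \<le> ln (real (\<tau> i a)) - real (r i) * ln (real a)"
        using a by (simp add: ln_realpow)
      then show "\<bar>ln (real (\<tau> i a)) - real (r i) * ln (real a)\<bar> \<le> ln (real (C i))" using up by simp
    qed simp
    finally show ?thesis .
  qed
  \<comment> \<open>Large enough that \<open>ln a\<close> exceeds
    \<open>\<bar>L 1\<bar> + K\<close>; since \<open>\<bar>S\<bar>\<close> is at least 1, this beats
    the bound.\<close>
  define a where "a = nat \<lceil>exp (\<bar>L 1\<bar> + K + 1)\<rceil>"
  have "exp (\<bar>L 1\<bar> + K + 1) \<le> real a" unfolding a_def by linarith
  moreover from this have a: "0 < a" using exp_gt_zero[of "\<bar>L 1\<bar> + K + 1"] by (cases a) auto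
  ultimately have ln_a: "\<bar>L 1\<bar> + K + 1 \<le> ln (real a)" by (simp add: ln_ge_iff)
  have "0 \<le> K" using bound[of 1] by linarith
  then have "ln (real a) \<le> \<bar>real_of_int S\<bar> * ln (real a)" 
    using mult_right_mono[OF S1, of "ln (real a)"] ln_a by simp
  also have "\<dots> = \<bar>real_of_int S * ln (real a)\<bar>" using \<open>0 \<le> K\<close> ln_a by (simp add: abs_mult)
  also have "\<dots> \<le> \<bar>L 1\<bar> + K" using bound[OF a] const[OF a] by linarith
  finally show False using ln_a by linarith
qed

section \<open>Subgroups of finite cyclic groups\<close>

lemma (in group) cyclic_group_iso:
  assumes g: "g \<in> carrier G" "carrier G = range (\<lambda>i :: int. g [^] i)" and "finite (carrier G)"
  shows "(\<lambda>i :: int. g [^] i) \<in> iso (integer_mod_group (ord g)) G"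
proof -
  have n: "0 < ord g" using ord_ge_1[OF assms(3) g(1)] by simp
  have eq: "g [^] (i :: int) = g [^] (k :: int) \<longleftrightarrow> int (ord g) dvd (k - i)" for i k
    using int_pow_eq[OF g(1)] .
  have mod: "g [^] (i mod int (ord g)) = g [^] i" for i :: int
    unfolding eq by (simp add: mod_eq_dvd_iff[symmetric])
  have "(\<lambda>i :: int. g [^] i) \<in> hom (integer_mod_group (ord g)) G"
    by (rule homI) (use g(1) in \<open>simp_all add: mod int_pow_mult\<close>)
  moreover have "bij_betw (\<lambda>i :: int. g [^] i) {0..<int (ord g)} (carrier G)"
    unfolding bij_betw_def
  proof
    show "inj_on (\<lambda>i :: int. g [^] i) {0..<int (ord g)}"
    proof (rule inj_onI)
      fix i k assume "i \<in> {0..<int (ord g)}" "k \<in> {0..<int (ord g)}" "g [^] i = g [^] k"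
      then show "i = k" unfolding eq by (auto simp: mod_eq_dvd_iff[symmetric])
    qed
    show "(\<lambda>i :: int. g [^] i) ` {0..<int (ord g)} = carrier G"
    proof (intro equalityI subsetI)
      fix x assume "x \<in> carrier G"
      then obtain i :: int where "x = g [^] i" using g(2) by blast
      then show "x \<in> (\<lambda>i :: int. g [^] i) ` {0..<int (ord g)}"
        using n by (intro image_eqI[of _ _ "i mod int (ord g)"]) (simp_all add: mod)
    qed (use g(1) in auto)
  qed
  ultimately show ?thesis using n by (simp add: iso_def carrier_integer_mod_group)
qed

text \<open>Division with remainder by the least positive exponent \<open>e\<close> whose power lies
  in \<open>K\<close>. That \<open>e\<close> divides \<open>ord g\<close> is the case of the
  exponent \<open>ord g\<close>, whose power is the identity.\<close>

lemma (in group) subgroup_of_cyclic: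
  assumes g: "g \<in> carrier G" "carrier G = range (\<lambda>i :: int. g [^] i)" and "finite (carrier G)"
    and K: "subgroup K G"
  shows "\<exists>e. e dvd ord g \<and> K = (\<lambda>i :: int. g [^] i) ` {i \<in> {0..<int (ord g)}. int e dvd i}"
proof -
  have n: "0 < ord g" using ord_ge_1[OF assms(3) g(1)] by simp
  have n_in: "g [^] int (ord g) \<in> K"
    using g(1) subgroup.one_closed[OF K] by (simp add: int_pow_int)
  define e where "e = (LEAST d :: nat. 0 < d \<and> g [^] int d \<in> K)"
  have e: "0 < e \<and> g [^] int e \<in> K"
    unfolding e_def by (rule LeastI[of _ "ord g"]) (use n n_in in simp)
  have least: "e \<le> d" if "0 < d" "g [^] int d \<in> K" for d
    unfolding e_def by (rule Least_le) (use that in simp)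
  have iff: "g [^] i \<in> K \<longleftrightarrow> int e dvd i" for i :: int
  proof
    assume "int e dvd i"
    then obtain k where "i = int e * k" by blast
    then have "g [^] i = (g [^] int e) [^] k" using g(1) by (simp add: int_pow_pow)
    then show "g [^] i \<in> K" using e subgroup_int_pow_closed[OF K] by simp
  next
    assume i: "g [^] i \<in> K"
    \<comment> \<open>The remainder is again an exponent of \<open>K\<close> and smaller than
      \<open>e\<close>, so minimality leaves only 0.\<close>
    have "g [^] (i mod int e) = g [^] i \<otimes> inv ((g [^] int e) [^] (i div int e))"
      using g(1) by (simp add: int_pow_pow int_pow_diff[symmetric] minus_mult_div_eq_mod)
    also have "\<dots> \<in> K"
      using subgroup.m_closed[OF K i subgroup.m_inv_closed[OF K subgroup_int_pow_closed[OF K]]] e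
      by simp
    finally have "g [^] int (nat (i mod int e)) \<in> K" using e by simp
    moreover have "nat (i mod int e) < e" using e by (simp add: nat_less_iff)
    ultimately have "\<not> 0 < nat (i mod int e)" using least[of "nat (i mod int e)"] by linarith
    moreover have "0 \<le> i mod int e" using e by simp
    ultimately have "i mod int e = 0" by linarith
    then show "int e dvd i" by (rule mod_0_imp_dvd)
  qed
  have "e dvd ord g" using iff[of "int (ord g)"] n_in by simp
  moreover have "K = (\<lambda>i :: int. g [^] i) ` {i \<in> {0..<int (ord g)}. int e dvd i}"
  proof (intro equalityI subsetI)
    fix x assume x: "x \<in> K"
    then have "x \<in> carrier G" using subgroup.subset[OF K] by blast
    then have "x \<in> (\<lambda>i :: int. g [^] i) ` {0..<int (ord g)}"
      using cyclic_group_iso[OF assms(1-3)] n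
      by (auto simp: iso_def bij_betw_def carrier_integer_mod_group)
    then show "x \<in> (\<lambda>i :: int. g [^] i) ` {i \<in> {0..<int (ord g)}. int e dvd i}"
      using iff x by auto
  qed (use iff in auto)
  ultimately show ?thesis by blast
qed

section \<open>Complexities in cyclic covers\<close>

theorem theorem1p3:
  fixes G :: "('g, 'x) monoid_scheme" and H :: "nat \<Rightarrow> 'g set" and k :: nat
  assumes "group G" and "finite (carrier G)" and "cyclic_group G" and "\<not> trivial_group G"
    and "bij_betw H {1..k} {K. subgroup K G}"
  shows "\<not> (\<exists>(m :: nat \<Rightarrow> int) (q :: rat). (\<exists>i \<in> {1..k}. m i \<noteq> 0) \<and>
    (\<forall>(Y :: (nat, nat) pre_digraph) \<iota>Y (B :: (nat, nat) pre_digraph) \<iota>B \<pi> \<phi>.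
       fin_digraph Y \<and> fin_digraph B \<and>
       Digraph_Component.connected Y \<and> Digraph_Component.connected B \<and>
       galois_cover Y \<iota>Y B \<iota>B \<pi> \<and> \<phi> \<in> iso G (deck_group Y \<iota>Y \<pi>) \<longrightarrow>
       q * (\<Prod>i = 1..k. of_nat (intermediate_complexity Y \<iota>Y \<pi> (\<phi> ` H i)) powi m i) = 1))"
proof
  assume "\<exists>(m :: nat \<Rightarrow> int) (q :: rat). (\<exists>i \<in> {1..k}. m i \<noteq> 0) \<and>
    (\<forall>(Y :: (nat, nat) pre_digraph) \<iota>Y (B :: (nat, nat) pre_digraph) \<iota>B \<pi> \<phi>.
       fin_digraph Y \<and> fin_digraph B \<and>
       Digraph_Component.connected Y \<and> Digraph_Component.connected B \<and>
       galois_cover Y \<iota>Y B \<iota>B \<pi> \<and> \<phi> \<in> iso G (deck_group Y \<iota>Y \<pi>) \<longrightarrow>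
       q * (\<Prod>i = 1..k. of_nat (intermediate_complexity Y \<iota>Y \<pi> (\<phi> ` H i)) powi m i) = 1)"
  then obtain m :: "nat \<Rightarrow> int" and q :: rat where m: "\<exists>i \<in> {1..k}. m i \<noteq> 0"
    and rel: "\<And>(Y :: (nat, nat) pre_digraph) \<iota>Y (B :: (nat, nat) pre_digraph) \<iota>B \<pi> \<phi>.
       \<lbrakk>fin_digraph Y; fin_digraph B; Digraph_Component.connected Y; Digraph_Component.connected B;
        galois_cover Y \<iota>Y B \<iota>B \<pi>; \<phi> \<in> iso G (deck_group Y \<iota>Y \<pi>)\<rbrakk> \<Longrightarrow>
       q * (\<Prod>i = 1..k. of_nat (intermediate_complexity Y \<iota>Y \<pi> (\<phi> ` H i)) powi m i) = 1"
    by blast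
  interpret group G by (rule assms(1))
  obtain g where g: "g \<in> carrier G" "carrier G = range (\<lambda>i :: int. g [^]\<^bsub>G\<^esub> i)"
    using assms(3) cyclic_group by blast
  define n where "n = ord g"
  have n: "0 < n" using ord_ge_1[OF assms(2) g(1)] by (simp add: n_def)
  define \<xi> where "\<xi> = (\<lambda>i :: int. g [^]\<^bsub>G\<^esub> i)"
  have \<xi>: "\<xi> \<in> iso (integer_mod_group n) G"
    unfolding \<xi>_def n_def by (rule cyclic_group_iso[OF g assms(2)])
  have carrier_n: "carrier (integer_mod_group n) = {0..<int n}"
    using n by (simp add: carrier_integer_mod_group)
  have H: "inj_on H {1..k}" "\<And>i. i \<in> {1..k} \<Longrightarrow> subgroup (H i) G"
    using assms(5) by (auto simp: bij_betw_def)
  have "\<forall>i \<in> {1..k}. \<exists>e. e dvd n \<and> H i = \<xi> ` {x \<in> {0..<int n}. int e dvd x}"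
    unfolding n_def \<xi>_def by (intro ballI subgroup_of_cyclic[OF g assms(2)] H(2))
  from bchoice[OF this] obtain e where e: "\<And>i. i \<in> {1..k} \<Longrightarrow> e i dvd n"
    and H_eq: "\<And>i. i \<in> {1..k} \<Longrightarrow> H i = \<xi> ` {x \<in> {0..<int n}. int (e i) dvd x}"
    by blast
  \<comment> \<open>\<open>e i\<close> determines \<open>H i\<close>, and distinct indices enumerate
    distinct subgroups.\<close>
  have inj_e: "inj_on e {1..k}"
  proof (rule inj_onI)
    fix i j assume "i \<in> {1..k}" "j \<in> {1..k}" "e i = e j"
    then show "i = j" using H_eq[of i] H_eq[of j] inj_onD[OF H(1), of i j] by simp
  qed
  have e_pos: "0 < e i" if "i \<in> {1..k}" for i
    using e[OF that] n by (rule dvd_pos_nat[rotated])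
  have trees: "q * (\<Prod>i = 1..k. of_nat (family_trees (int (e i)) c a) powi m i) = 1" if a: "0 < a" for c a
  proof -
    let ?J = "{0..2 * a}" and ?w = "family_voltage a c"
    \<comment> \<open>Edge 1 has voltage 0 because \<open>a\<close> is positive, and edge 0 has
      voltage 1.\<close>
    interpret C: dipole_cover "int n" ?J ?w 1 0
      by unfold_locales (use n a in \<open>auto simp: family_voltage_def\<close>)
    \<comment> \<open>\<open>G\<close> is identified with the deck group through the integers modulo
      \<open>n\<close>, so that \<open>H i\<close> becomes the translations by multiples of
      \<open>e i\<close>.\<close>
    define \<phi> where "\<phi> = translation (int n) ?J \<circ> inv_into {0..<int n} \<xi>"
    have "inv_into {0..<int n} \<xi> \<in> iso G (integer_mod_group n)"
      using group.iso_set_sym[OF group_integer_mod_group \<xi>] by (simp only: carrier_n)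
    moreover have "translation (int n) ?J \<in> iso (integer_mod_group n) C.D"
      using C.tr_iso by simp
    ultimately have \<phi>: "\<phi> \<in> iso G C.D" unfolding \<phi>_def by (rule iso_set_trans)
    have "intermediate_complexity C.Y C.\<iota>Y dipole_proj (\<phi> ` H i) = family_trees (int (e i)) c a"
      if i: "i \<in> {1..k}" for i
    proof -
      have "inj_on \<xi> {0..<int n}" using \<xi> by (simp add: iso_def bij_betw_def carrier_n)
      then have "inv_into {0..<int n} \<xi> ` H i = {x \<in> {0..<int n}. int (e i) dvd x}"
        unfolding H_eq[OF i] by (rule inv_into_image_cancel) auto
      then have "\<phi> ` H i = translation (int n) ?J ` {x \<in> {0..<int n}. int (e i) dvd x}"
        by (simp only: \<phi>_def image_comp[symmetric])
      then show ?thesis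
        using C.intermediate_complexity_dipole[of "int (e i)"] e_pos[OF i] e[OF i]
        by (simp add: family_trees_def)
    qed
    then show ?thesis
      using rel[OF C.Y.fin_digraph C.B.fin_digraph C.connected_Y C.connected_B C.galois \<phi>] by simp
  qed
  have rank: "(\<Sum>i = 1..k. m i * (2 * int (e i) - int (gcd (e i) c))) = 0" if "c dvd n" for c
  proof -
    let ?r = "\<lambda>i. family_rank (int (e i)) (int c)"
    have "(\<Sum>i = 1..k. m i * int (?r i)) = 0"
    \<comment> \<open>The constant \<open>C i\<close> absorbs the choices among the voltage 1 edges
      and the estimate \<open>2 * e i * a + 1 \<le> (2 * e i + 1) * a\<close> for positive
      \<open>a\<close>.\<close>
    proof (rule growth_relation[where \<tau> = "\<lambda>i. family_trees (int (e i)) (int c)"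
          and C = "\<lambda>i. 2 ^ e i * (2 * e i + 1) ^ ?r i" and q = q])
      fix i a :: nat assume i: "i \<in> {1..k}" and a: "0 < a"
      show "a ^ ?r i \<le> family_trees (int (e i)) (int c) a"
        using family_trees_ge[of "int (e i)" a] e_pos[OF i] a by simp
      have "family_trees (int (e i)) (int c) a \<le> 2 ^ e i * (e i * (2 * a) + 1) ^ ?r i"
        using family_trees_le[of "int (e i)" a "int c"] e_pos[OF i] a by simp
      also have "\<dots> \<le> 2 ^ e i * ((2 * e i + 1) * a) ^ ?r i"
        using a by (intro mult_left_mono power_mono) (auto simp: algebra_simps)
      finally show "family_trees (int (e i)) (int c) a \<le> 2 ^ e i * (2 * e i + 1) ^ ?r i * a ^ ?r i"
        by (simp only: power_mult_distrib mult.assoc)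
    qed (use trees in auto)
    moreover have "int (?r i) = 2 * int (e i) - int (gcd (e i) c)" if "i \<in> {1..k}" for i
    proof -
      have "gcd (e i) c \<le> e i" using e_pos[OF that] by (simp add: gcd_le1_nat)
      then show ?thesis by (simp add: family_rank_def gcd_int_int_eq)
    qed
    ultimately show ?thesis by simp
  qed
  \<comment> \<open>At \<open>c = n\<close> the gcd is \<open>e i\<close>, so each coefficient
    \<open>2 * e i - gcd (e i) c\<close> is \<open>e i\<close>. With this sum known to vanish, the
    relation for general \<open>c\<close> leaves the gcd sums.\<close>
  have "(\<Sum>i = 1..k. m i * int (e i)) = 0"
  proof -
    have "gcd (e i) n = e i" if "i \<in> {1..k}" for i using e[OF that] by simp
    then show ?thesis using rank[of n] by simp
  qed
  then have "(\<Sum>i = 1..k. m i * int (gcd (e i) c)) = 0" if "c dvd n" for c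
  proof -
    have "(\<Sum>i = 1..k. m i * (2 * int (e i))) = 2 * (\<Sum>i = 1..k. m i * int (e i))"
      by (simp add: sum_distrib_left mult.left_commute)
    then show ?thesis
      using rank[OF that] \<open>(\<Sum>i = 1..k. m i * int (e i)) = 0\<close>
      by (simp add: right_diff_distrib sum_subtractf)
  qed
  then have "\<forall>i \<in> {1..k}. m i = 0"
    by (intro gcd_relation_trivial[OF _ inj_e n e]) auto
  then show False using m by blast
qed

end
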